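(* Let $n\ge 1$. Each nonzero Killing vector field $\xi$ (written as a 1-form) in $\mathbb{R}^{n,1}$ can be brought into one of the following forms by a Poincaré transformation (here $r\ge1$ is an integer wherever it appears): (a) $n\ge 1$: $\xi=f_0\,dx^0$, $f_0<0$; (b) $n\ge 1$: $\xi=f_n\,dx^n$, $f_n>0$; (c) $n\ge 1$: $\xi=-dx^0+dx^n$; (d) $n\ge 1$: $\xi=a(x^0dx^1-x^1dx^0)$, $a>0$; (e) $n\ge 2$, $r\le n/2$: $\xi=\sum_{i=1}^r b_i(x^{2i-1}dx^{2i}-x^{2i}dx^{2i-1})+f_0\,dx^0$, $b_1\ge\dots\ge b_r>0$, $f_0\le 0$; (f) $n\ge 2$: $\xi=a(x^0dx^1-x^1dx^0)+f_n\,dx^n$, $a>0$, $f_n>0$; (g) $n\ge 2$: $\xi=(x^0-x^2)dx^1-x^1(dx^0-dx^2)+f_0\,dx^0$, $f_0\le 0$; (h) $n\ge 3$, $r<n/2$: $\xi=\sum_{i=1}^r b_i(x^{2i-1}dx^{2i}-x^{2i}dx^{2i-1})+f_n\,dx^n$, $b_1\ge\dots\ge b_r>0$, $f_n>0$; (i) $n\ge 3$, $r<n/2$: $\xi=\sum_{i=1}^r b_i(x^{2i-1}dx^{2i}-x^{2i}dx^{2i-1})-dx^0+dx^n$, $b_1\ge\dots\ge b_r>0$; (j) $n\ge 3$, $r\le (n-1)/2$: $\xi=a(x^0dx^1-x^1dx^0)+\sum_{i=1}^r b_i(x^{2i}dx^{2i+1}-x^{2i+1}dx^{2i})$, $a>0$,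 $b_1\ge\dots\ge b_r>0$; (k) $n\ge 3$: $\xi=(x^0-x^2)dx^1-x^1(dx^0-dx^2)+f_n\,dx^n$, $f_n>0$; (l) $n\ge 4$, $r<(n-1)/2$: $\xi=a(x^0dx^1-x^1dx^0)+\sum_{i=1}^r b_i(x^{2i}dx^{2i+1}-x^{2i+1}dx^{2i})+f_n\,dx^n$, $a>0$, $b_1\ge\dots\ge b_r>0$, $f_n>0$; (m) $n\ge 4$, $r\le (n/2)-1$: $\xi=(x^0-x^2)dx^1-x^1(dx^0-dx^2)+\sum_{i=1}^r b_i(x^{2i+1}dx^{2i+2}-x^{2i+2}dx^{2i+1})+f_0\,dx^0$, $b_1\ge\dots\ge b_r>0$, $f_0\le 0$; (n) $n\ge 5$, $r<(n/2)-1$: $\xi=(x^0-x^2)dx^1-x^1(dx^0-dx^2)+\sum_{i=1}^r b_i(x^{2i+1}dx^{2i+2}-x^{2i+2}dx^{2i+1})+f_n\,dx^n$, $b_1\ge\dots\ge b_r>0$, $f_n>0$.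
   Context: $\mathbb{R}^{n,1}$ is the $(n+1)$-dimensional Minkowski spacetime with inertial coordinates $(x^0,x^1,\dots,x^n)$ and metric $\eta=-(dx^0)^2+\sum_{i=1}^n(dx^i)^2$. A Killing vector field is identified with its metric dual 1-form $\xi=\xi_\nu dx^\nu$; the Killing equation is $\partial_\mu\xi_\nu+\partial_\nu\xi_\mu=0$, and its general solution is $\xi=F_{\mu\nu}x^\mu dx^\nu+f_\nu dx^\nu$ with $F_{\mu\nu}=-F_{\nu\mu}$ and $f_\nu$ real constants (summation over repeated indices). A Poincaré transformation is a change of inertial coordinates $x'^\mu=\Lambda^\mu{}_\nu x^\nu+c^\mu$, with $\Lambda$ in the full Lorentz group $O_{n,1}$ and $c\in\mathbb{R}^{n+1}$; "brought into the form" means that $\xi$ has the stated expression in the new coordinates. *)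

theory Defs
  imports "HOL-Analysis.Analysis"
begin

text \<open>
  The (n+1)-dimensional Minkowski spacetime is modelled on \<open>real ^ 'd\<close>. The inertial coordinates
  \<open>x\<^sup>0, \<dots>, x\<^sup>n\<close> are the components \<open>x $ \<iota> 0, \<dots>, x $ \<iota> n\<close>, where the labelling \<open>\<iota>\<close> is a bijection
  from \<open>{0..n}\<close> onto the index type; in particular \<open>CARD('d) = n + 1\<close>. A 1-form field is the map
  sending a point to its vector of covariant components.
\<close>

definition minkowski_metric :: "'d::finite \<Rightarrow> real ^ 'd ^ 'd" where
  "minkowski_metric t = (\<chi> \<mu> \<nu>. if \<mu> = \<nu> then (if \<mu> = t then -1 else 1) else 0)"

definition lorentz_group :: "'d::finite \<Rightarrow> (real ^ 'd ^ 'd) set" where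
  "lorentz_group t =
    {\<Lambda>. transpose \<Lambda> ** minkowski_metric t ** \<Lambda> = minkowski_metric t}"

definition partial :: "'d::finite \<Rightarrow> (real ^ 'd \<Rightarrow> real) \<Rightarrow> real ^ 'd \<Rightarrow> real" where
  "partial \<mu> u x = frechet_derivative u (at x) (axis \<mu> 1)"

primrec cont_diff :: "nat \<Rightarrow> (real ^ 'd::finite \<Rightarrow> real) \<Rightarrow> bool" where
  "cont_diff 0 u \<longleftrightarrow> continuous_on UNIV u"
| "cont_diff (Suc k) u \<longleftrightarrow> (\<forall>x. u differentiable at x) \<and> (\<forall>\<mu>. cont_diff k (partial \<mu> u))"

definition smooth :: "(real ^ 'd::finite \<Rightarrow> real) \<Rightarrow> bool" where
  "smooth u \<longleftrightarrow> (\<forall>k. cont_diff k u)"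

text \<open>
  The metric dual of a Killing vector field. In inertial coordinates the Christoffel symbols vanish,
  so the Killing equation for the covariant components does not involve the metric.
\<close>

definition killing_field_dual :: "(real ^ 'd::finite \<Rightarrow> real ^ 'd) \<Rightarrow> bool" where
  "killing_field_dual \<xi> \<longleftrightarrow>
    (\<forall>\<nu>. smooth (\<lambda>x. \<xi> x $ \<nu>)) \<and>
    (\<forall>x \<mu> \<nu>. partial \<mu> (\<lambda>y. \<xi> y $ \<nu>) x + partial \<nu> (\<lambda>y. \<xi> y $ \<mu>) x = 0)"

text \<open>
  If a 1-form field is \<open>\<omega>\<^sub>\<mu>(x') dx'\<^sup>\<mu>\<close> in the coordinates \<open>x' = \<Lambda> x + c\<close>, then, as
  \<open>dx'\<^sup>\<mu> = \<Lambda>\<^sup>\<mu>\<^sub>\<nu> dx\<^sup>\<nu>\<close>, its components in the coordinates \<open>x\<close> are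
  \<open>\<Lambda>\<^sup>\<mu>\<^sub>\<nu> \<omega>\<^sub>\<mu>(\<Lambda> x + c)\<close>.
\<close>

definition from_new_coords ::
  "real ^ 'd ^ 'd \<Rightarrow> real ^ 'd \<Rightarrow> (real ^ 'd::finite \<Rightarrow> real ^ 'd) \<Rightarrow> real ^ 'd \<Rightarrow> real ^ 'd" where
  "from_new_coords \<Lambda> c \<omega> = (\<lambda>x. transpose \<Lambda> *v \<omega> (\<Lambda> *v x + c))"

definition dx :: "(nat \<Rightarrow> 'd::finite) \<Rightarrow> nat \<Rightarrow> real ^ 'd" where
  "dx \<iota> k = axis (\<iota> k) 1"

text \<open>The 1-form \<open>x\<^sup>j dx\<^sup>k - x\<^sup>k dx\<^sup>j\<close>.\<close>

definition rot :: "(nat \<Rightarrow> 'd::finite) \<Rightarrow> nat \<Rightarrow> nat \<Rightarrow> real ^ 'd \<Rightarrow> real ^ 'd" where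
  "rot \<iota> j k x = (x $ \<iota> j) *\<^sub>R dx \<iota> k - (x $ \<iota> k) *\<^sub>R dx \<iota> j"

text \<open>The 1-form \<open>(x\<^sup>0 - x\<^sup>2) dx\<^sup>1 - x\<^sup>1 (dx\<^sup>0 - dx\<^sup>2)\<close>.\<close>

definition null_rot :: "(nat \<Rightarrow> 'd::finite) \<Rightarrow> real ^ 'd \<Rightarrow> real ^ 'd" where
  "null_rot \<iota> x =
    (x $ \<iota> 0 - x $ \<iota> 2) *\<^sub>R dx \<iota> 1 - (x $ \<iota> 1) *\<^sub>R (dx \<iota> 0 - dx \<iota> 2)"

text \<open>The condition \<open>b\<^sub>1 \<ge> \<dots> \<ge> b\<^sub>r > 0\<close> with \<open>r \<ge> 1\<close>.\<close>

definition rot_coeffs :: "nat \<Rightarrow> (nat \<Rightarrow> real) \<Rightarrow> bool" where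
  "rot_coeffs r b \<longleftrightarrow> 1 \<le> r \<and> antimono_on {1..r} b \<and> 0 < b r"

text \<open>The bounds on \<open>r\<close> are stated without fractions, e.g. \<open>2 * r + 1 < n\<close> for \<open>r < (n - 1) / 2\<close>.\<close>

inductive killing_normal_form ::
  "nat \<Rightarrow> (nat \<Rightarrow> 'd::finite) \<Rightarrow> (real ^ 'd \<Rightarrow> real ^ 'd) \<Rightarrow> bool"
  for n :: nat and \<iota> :: "nat \<Rightarrow> 'd" where
  form_a: "\<lbrakk>1 \<le> n; f0 < 0\<rbrakk> \<Longrightarrow>
    killing_normal_form n \<iota> (\<lambda>x. f0 *\<^sub>R dx \<iota> 0)"
| form_b: "\<lbrakk>1 \<le> n; fn > 0\<rbrakk> \<Longrightarrow>
    killing_normal_form n \<iota> (\<lambda>x. fn *\<^sub>R dx \<iota> n)"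
| form_c: "1 \<le> n \<Longrightarrow>
    killing_normal_form n \<iota> (\<lambda>x. - dx \<iota> 0 + dx \<iota> n)"
| form_d: "\<lbrakk>1 \<le> n; a > 0\<rbrakk> \<Longrightarrow>
    killing_normal_form n \<iota> (\<lambda>x. a *\<^sub>R rot \<iota> 0 1 x)"
| form_e: "\<lbrakk>2 \<le> n; 2 * r \<le> n; rot_coeffs r b; f0 \<le> 0\<rbrakk> \<Longrightarrow>
    killing_normal_form n \<iota>
      (\<lambda>x. (\<Sum>i=1..r. b i *\<^sub>R rot \<iota> (2 * i - 1) (2 * i) x) + f0 *\<^sub>R dx \<iota> 0)"
| form_f: "\<lbrakk>2 \<le> n; a > 0; fn > 0\<rbrakk> \<Longrightarrow>
    killing_normal_form n \<iota> (\<lambda>x. a *\<^sub>R rot \<iota> 0 1 x + fn *\<^sub>R dx \<iota> n)"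
| form_g: "\<lbrakk>2 \<le> n; f0 \<le> 0\<rbrakk> \<Longrightarrow>
    killing_normal_form n \<iota> (\<lambda>x. null_rot \<iota> x + f0 *\<^sub>R dx \<iota> 0)"
| form_h: "\<lbrakk>3 \<le> n; 2 * r < n; rot_coeffs r b; fn > 0\<rbrakk> \<Longrightarrow>
    killing_normal_form n \<iota>
      (\<lambda>x. (\<Sum>i=1..r. b i *\<^sub>R rot \<iota> (2 * i - 1) (2 * i) x) + fn *\<^sub>R dx \<iota> n)"
| form_i: "\<lbrakk>3 \<le> n; 2 * r < n; rot_coeffs r b\<rbrakk> \<Longrightarrow>
    killing_normal_form n \<iota>
      (\<lambda>x. (\<Sum>i=1..r. b i *\<^sub>R rot \<iota> (2 * i - 1) (2 * i) x) - dx \<iota> 0 + dx \<iota> n)"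
| form_j: "\<lbrakk>3 \<le> n; 2 * r + 1 \<le> n; a > 0; rot_coeffs r b\<rbrakk> \<Longrightarrow>
    killing_normal_form n \<iota>
      (\<lambda>x. a *\<^sub>R rot \<iota> 0 1 x + (\<Sum>i=1..r. b i *\<^sub>R rot \<iota> (2 * i) (2 * i + 1) x))"
| form_k: "\<lbrakk>3 \<le> n; fn > 0\<rbrakk> \<Longrightarrow>
    killing_normal_form n \<iota> (\<lambda>x. null_rot \<iota> x + fn *\<^sub>R dx \<iota> n)"
| form_l: "\<lbrakk>4 \<le> n; 2 * r + 1 < n; a > 0; rot_coeffs r b; fn > 0\<rbrakk> \<Longrightarrow>
    killing_normal_form n \<iota>
      (\<lambda>x. a *\<^sub>R rot \<iota> 0 1 x + (\<Sum>i=1..r. b i *\<^sub>R rot \<iota> (2 * i) (2 * i + 1) x)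
            + fn *\<^sub>R dx \<iota> n)"
| form_m: "\<lbrakk>4 \<le> n; 2 * r + 2 \<le> n; rot_coeffs r b; f0 \<le> 0\<rbrakk> \<Longrightarrow>
    killing_normal_form n \<iota>
      (\<lambda>x. null_rot \<iota> x + (\<Sum>i=1..r. b i *\<^sub>R rot \<iota> (2 * i + 1) (2 * i + 2) x)
            + f0 *\<^sub>R dx \<iota> 0)"
| form_n: "\<lbrakk>5 \<le> n; 2 * r + 2 < n; rot_coeffs r b; fn > 0\<rbrakk> \<Longrightarrow>
    killing_normal_form n \<iota>
      (\<lambda>x. null_rot \<iota> x + (\<Sum>i=1..r. b i *\<^sub>R rot \<iota> (2 * i + 1) (2 * i + 2) x)
            + fn *\<^sub>R dx \<iota> n)"

end

theory Submission
  imports Defs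
begin

text \<open>
  The Killing equation makes \<open>\<xi>\<close> affine, \<open>\<xi> = \<eta> (K x + \<phi>)\<close> with \<open>K\<close> skew for the Minkowski
  product \<open>g\<close>. By Brouwer \<open>K\<close> has a causal eigenvector. It yields a \<open>K\<close>-invariant Lorentzian
  subspace on which \<open>K\<close> vanishes (dimension 1), is a boost (dimension 2) or is a null rotation
  (dimension 3, from a null vector \<open>v = K (K u)\<close> with \<open>K v = 0\<close>). On the Euclidean complement \<open>K\<close>
  splits into rotations of orthogonal planes and zero. A translation changes \<open>\<phi>\<close> by an arbitrary
  element of the range of \<open>K\<close>, and Lorentz transformations that preserve the shape of \<open>K\<close> normalise
  what is left of \<open>\<phi>\<close>.
\<close>

text \<open>The product \<open>g\<close> is indefinite, so neither the spectral theorem nor a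
  maximum of a quotient of quadratic forms is available on the whole space. Hence the Lorentzian
  block has to come first: it leaves a complement on which \<open>g\<close> is positive definite.
  After translations only the class of \<phi> modulo the range of \<open>K\<close> matters, and the
  type of block decides how far it can be simplified. If \<open>K\<close> kills a timelike vector,
  the kernel is Lorentzian and the remainder can be timelike, null or spacelike. For a boost the
  kernel is positive definite, so only a spacelike remainder survives. For a null rotation, range
  and kernel share the null vector \<open>v\<close>; modulo \<open>v\<close> a time part and a
  spatial part remain, and a nonzero time part absorbs the spatial one. A spatial remainder must sit
  at index \<open>n\<close>, whereas the blocks fill an initial segment of the indices; therefore
  frames are built with gaps and completed last. Negative time coefficients can always be reached
  because the full Lorentz group contains time reversal.\<close>

text \<open>This first-order condition at a minimum stands in for differentiating the quotient in
  \<open>exists_rotation_plane\<close>.\<close>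

lemma linear_coeff_zero:
  fixes p q :: real
  assumes "\<And>s. 0 \<le> 2 * s * p + s * s * q"
  shows "p = 0"
proof (rule ccontr)
  assume "p \<noteq> 0"
  \<comment> \<open>Since \<open>q \<le> d - 1\<close>, at \<open>s = - p / d\<close> the quadratic
    term cannot outweigh the linear one.\<close>
  define d where "d = 1 + \<bar>q\<bar>"
  have "0 < d" by (simp add: d_def)
  have "(- p / d) * (- p / d) * q \<le> (- p / d) * (- p / d) * (d - 1)"
    by (intro mult_left_mono) (auto simp: d_def)
  then have "0 \<le> 2 * (- p / d) * p + (- p / d) * (- p / d) * (d - 1)"
    using assms[of "- p / d"] by linarith
  also have "\<dots> = - (p * p) * (1 / d + 1 / (d * d))"
    using \<open>0 < d\<close> by (simp add: field_simps)
  also have "\<dots> < 0" using \<open>p \<noteq> 0\<close> \<open>0 < d\<close>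
    by (intro mult_neg_pos add_pos_pos) (auto simp: zero_less_mult_iff)
  finally show False by simp
qed

section \<open>The Minkowski product and causal vectors\<close>

locale minkowski =
  fixes t :: "'d::finite"
begin

definition g :: "real ^ 'd \<Rightarrow> real ^ 'd \<Rightarrow> real" where
  "g u v = u \<bullet> v - 2 * (u $ t) * (v $ t)"

text \<open>This is the metric as an operator. It is its own inverse, so it both lowers and raises
  indices.\<close>

definition time_flip :: "real ^ 'd \<Rightarrow> real ^ 'd" where
  "time_flip v = v - (2 * v $ t) *\<^sub>R axis t 1"

lemma g_add: "g (u + v) w = g u w + g v w" "g w (u + v) = g w u + g w v"
  and g_diff: "g (u - v) w = g u w - g v w" "g w (u - v) = g w u - g w v"
  and g_minus: "g (- u) w = - g u w" "g w (- u) = - g w u"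
  and g_scale: "g (c *\<^sub>R u) w = c * g u w" "g w (c *\<^sub>R u) = c * g w u"
  and g_zero: "g 0 w = 0" "g w 0 = 0"
  by (simp_all add: g_def algebra_simps)

lemmas g_simps = g_add g_diff g_minus g_scale g_zero

lemma g_commute: "g u v = g v u"
  by (simp add: g_def inner_commute)

lemma linear_g: "linear (g u)"
  by (intro linearI) (simp_all add: g_simps)

lemma g_sum: "g u (\<Sum>i\<in>I. f i) = (\<Sum>i\<in>I. g u (f i))"
  using linear_sum[OF linear_g] .

lemma continuous_on_g [continuous_intros]:
  "continuous_on S f \<Longrightarrow> continuous_on S h \<Longrightarrow> continuous_on S (\<lambda>x. g (f x) (h x))"
  unfolding g_def by (intro continuous_intros)

lemma inner_time_flip: "time_flip u \<bullet> v = g u v" "u \<bullet> time_flip v = g u v"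
  by (simp_all add: time_flip_def g_def inner_diff_left inner_diff_right inner_axis inner_axis')

lemma linear_time_flip: "linear time_flip"
  by (intro linearI) (simp_all add: time_flip_def algebra_simps)

lemma time_flip_time_flip [simp]: "time_flip (time_flip v) = v"
  by (simp add: time_flip_def axis_def vec_eq_iff)

lemma g_time_flip: "g (time_flip u) v = u \<bullet> v" "g u (time_flip v) = u \<bullet> v"
  using inner_time_flip(1)[of "time_flip u" v] inner_time_flip(2)[of u "time_flip v"] by simp_all

lemma g_nondegenerate:
  assumes "\<And>y. g x y = 0" shows "x = 0"
proof -
  have "g x (time_flip x) = x \<bullet> x" by (rule g_time_flip)
  then show ?thesis using assms by simp
qed

text \<open>Cauchy-Schwarz for the spatial parts bounds the product of the time components. As the
  spatial part of \<open>e\<close> is shorter than its time part, that of \<open>z\<close> has to be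
  longer.\<close>

lemma timelike_perp:
  assumes "g e e < 0" "g e z = 0" "z \<noteq> 0"
  shows "0 < g z z"
proof -
  define e' where "e' = e - (e $ t) *\<^sub>R axis t 1"
  define z' where "z' = z - (z $ t) *\<^sub>R axis t 1"
  have ee: "g e e = e' \<bullet> e' - (e $ t)\<^sup>2" and zz: "g z z = z' \<bullet> z' - (z $ t)\<^sup>2"
    and ez: "g e z = e' \<bullet> z' - (e $ t) * (z $ t)"
    by (simp_all add: e'_def z'_def g_def inner_diff_left inner_diff_right inner_axis inner_axis'
        power2_eq_square algebra_simps)
  show ?thesis
  proof (cases "z $ t = 0")
    case True
    then have "z' = z" by (simp add: z'_def)
    with True zz assms(3) show ?thesis by simp
  next
    case False
    have cs: "((e $ t) * (z $ t))\<^sup>2 \<le> (e' \<bullet> e') * (z' \<bullet> z')"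
      using Cauchy_Schwarz_ineq[of e' z'] ez assms(2) by simp
    have "(e' \<bullet> e') * (z $ t)\<^sup>2 < (e $ t)\<^sup>2 * (z $ t)\<^sup>2"
      using ee assms(1) False by (intro mult_strict_right_mono) auto
    with cs have "(e' \<bullet> e') * (z $ t)\<^sup>2 < (e' \<bullet> e') * (z' \<bullet> z')"
      by (simp add: power_mult_distrib)
    then have "(z $ t)\<^sup>2 < z' \<bullet> z'"
      using inner_ge_zero[of e'] by (rule mult_left_less_imp_less)
    then show ?thesis using zz by simp
  qed
qed

text \<open>Subtracting a multiple of \<open>v\<close> does not change \<open>g z z\<close> and
  makes \<open>z\<close> orthogonal to the time axis, where \<open>timelike_perp\<close>
  applies.\<close>

lemma null_perp:
  assumes "g v v = 0" "v \<noteq> 0" "g v z = 0"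
  shows "0 < g z z \<or> (\<exists>c. z = c *\<^sub>R v)"
proof -
  define e :: "real ^ 'd" where "e = axis t 1"
  have ee: "g e e < 0" by (simp add: e_def g_def inner_axis)
  have ev: "g e v \<noteq> 0"
    using timelike_perp[OF ee, of v] assms by auto
  define w where "w = z - (g e z / g e v) *\<^sub>R v"
  have "g e w = 0" using ev by (simp add: w_def g_simps)
  moreover have "g w w = g z z"
    using assms by (simp add: w_def g_simps g_commute[of z v])
  ultimately show ?thesis
    using timelike_perp[OF ee, of w] by (cases "w = 0") (auto simp: w_def)
qed

subsection \<open>Orthonormal frames\<close>

text \<open>The index set is arbitrary: it may have a gap below an already placed vector
  \<open>e n\<close>, and it may lack 0 while the timelike vector is being replaced.\<close>

definition frame :: "nat set \<Rightarrow> (nat \<Rightarrow> real ^ 'd) \<Rightarrow> bool" where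
  "frame I e \<longleftrightarrow>
    (\<forall>i\<in>I. \<forall>j\<in>I. g (e i) (e j) = (if i = j then (if i = 0 then -1 else 1) else 0))"

lemma frameD:
  assumes "frame I e" "i \<in> I" "j \<in> I"
  shows "g (e i) (e j) = (if i = j then (if i = 0 then -1 else 1) else 0)"
  using assms unfolding frame_def by blast

lemma frame_subset: "frame I e \<Longrightarrow> J \<subseteq> I \<Longrightarrow> frame J e"
  unfolding frame_def by blast

lemma frame_insert:
  assumes "frame I e" "j \<notin> I" "\<And>i. i \<in> I \<Longrightarrow> g (e i) z = 0"
    and "g z z = (if j = 0 then -1 else 1)"
  shows "frame (insert j I) (e(j := z))"
proof -
  have "g z (e i) = 0" if "i \<in> I" for i
    using assms(3)[OF that] by (simp only: g_commute[of z])
  then show ?thesis using assms unfolding frame_def by auto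
qed

lemma frame_perp_pos:
  assumes "frame I e" "0 \<in> I" "\<And>i. i \<in> I \<Longrightarrow> g (e i) z = 0" "z \<noteq> 0"
  shows "0 < g z z"
  using timelike_perp[of "e 0" z] frameD[OF assms(1,2,2)] assms by auto

text \<open>Pairing a linear relation with \<open>e j\<close> isolates its coefficient at
  \<open>j\<close> up to sign. The bounds on \<open>r\<close> in terms of \<open>n\<close> all come
  from this count.\<close>

lemma frame_card_le:
  assumes "frame I e" "finite I"
  shows "card I \<le> CARD('d)"
proof -
  have c0: "c j = 0" if s: "(\<Sum>i\<in>I. c i *\<^sub>R e i) = 0" and j: "j \<in> I" for c j
  proof -
    have "0 = g (e j) (\<Sum>i\<in>I. c i *\<^sub>R e i)" by (simp add: s g_simps)
    also have "\<dots> = (\<Sum>i\<in>I. if i = j then c j * g (e j) (e j) else 0)"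
      unfolding g_sum using frameD[OF assms(1) j] j by (intro sum.cong) (simp_all add: g_simps)
    also have "\<dots> = c j * g (e j) (e j)" using assms(2) j by simp
    finally show ?thesis using frameD[OF assms(1) j j] by (cases "j = 0") auto
  qed
  have inj: "inj_on e I"
  proof (rule inj_onI, rule ccontr)
    fix i j assume "i \<in> I" "j \<in> I" "e i = e j" "i \<noteq> j"
    then show False using frameD[OF assms(1), of i j] frameD[OF assms(1), of i i]
      by (auto split: if_splits)
  qed
  have "independent (e ` I)"
  proof (rule independent_if_scalars_zero)
    show "finite (e ` I)" using assms(2) by simp
    fix f x assume "(\<Sum>x\<in>e ` I. f x *\<^sub>R x) = 0" "x \<in> e ` I"
    then show "f x = 0" using c0[of "f \<circ> e"] by (auto simp: sum.reindex[OF inj])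
  qed
  then have "card (e ` I) \<le> DIM(real ^ 'd)" by (rule independent_bound[THEN conjunct2])
  then show ?thesis by (simp add: card_image[OF inj])
qed

lemma frame_extend_one:
  assumes fr: "frame I e" and fin: "finite I" and "0 \<in> I" "j \<notin> I" and card: "card I < CARD('d)"
  obtains z where "frame (insert j I) (e(j := z))"
proof -
  \<comment> \<open>Orthogonality to \<open>e i\<close> for \<open>g\<close> is Euclidean
    orthogonality to \<open>time_flip (e i)\<close>, so a dimension count yields a new direction. It
    is spacelike because \<open>e 0\<close> is timelike.\<close>
  have "dim (time_flip ` e ` I) \<le> card (time_flip ` e ` I)"
    using fin by (intro dim_le_card) (auto intro: span_base)
  also have "\<dots> \<le> card I" using fin by (metis card_image_le finite_imageI le_trans)
  finally have "dim (time_flip ` e ` I) < DIM(real ^ 'd)" using card by simp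
  then obtain x where x: "x \<noteq> 0" "\<And>y. y \<in> span (time_flip ` e ` I) \<Longrightarrow> orthogonal x y"
    using orthogonal_to_subspace_exists by blast
  have perp: "g (e i) x = 0" if "i \<in> I" for i
    using x(2)[of "time_flip (e i)"] that span_base[of "time_flip (e i)"]
    by (auto simp: orthogonal_def inner_time_flip g_commute)
  have pos: "0 < g x x" using frame_perp_pos[OF fr \<open>0 \<in> I\<close> perp x(1)] .
  have "j \<noteq> 0" using \<open>0 \<in> I\<close> \<open>j \<notin> I\<close> by metis
  have "frame (insert j I) (e(j := (1 / sqrt (g x x)) *\<^sub>R x))"
    using pos perp \<open>j \<notin> I\<close> \<open>j \<noteq> 0\<close>
    by (intro frame_insert fr) (auto simp: g_simps field_simps)
  then show thesis by (rule that)
qed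

lemma frame_extend:
  assumes "frame I e" "finite J" "I \<subseteq> J" "0 \<in> I" "card J \<le> CARD('d)"
  obtains e' where "frame J e'" "\<And>i. i \<in> I \<Longrightarrow> e' i = e i"
proof -
  have "finite (J - I)" using assms(2) by simp
  then have "\<exists>e'. frame J e' \<and> (\<forall>i\<in>I. e' i = e i)"
    using assms
  proof (induction "J - I" arbitrary: I e rule: finite_induct)
    case empty
    then have "I = J" by blast
    with empty show ?case by auto
  next
    case (insert j F)
    then have j: "j \<in> J" "j \<notin> I" and F: "F = J - insert j I" by auto
    have "I \<subset> J" using j insert.prems by blast
    then have "card I < card J" using insert.prems by (intro psubset_card_mono)
    moreover have "finite I" using insert.prems finite_subset by blast
    ultimately obtain z where z: "frame (insert j I) (e(j := z))"
      using frame_extend_one[of I e j] insert.prems j by auto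
    have "\<exists>e'. frame J e' \<and> (\<forall>i\<in>insert j I. e' i = (e(j := z)) i)"
      using insert.prems j z by (intro insert.hyps(3)[OF F]) (auto simp del: fun_upd_apply)
    then obtain e' where "frame J e'" "\<forall>i\<in>insert j I. e' i = (e(j := z)) i" by blast
    then show ?case using j by (intro exI[of _ e']) auto
  qed
  then show thesis using that by blast
qed

lemma frame_full_perp:
  assumes "frame {0..n} e" "CARD('d) = n + 1" "\<And>i. i \<le> n \<Longrightarrow> g (e i) z = 0"
  shows "z = 0"
proof (rule ccontr)
  assume "z \<noteq> 0"
  then have pos: "0 < g z z" using frame_perp_pos[OF assms(1), of z] assms(3) by auto
  have "frame (insert (n + 1) {0..n}) (e(n + 1 := (1 / sqrt (g z z)) *\<^sub>R z))"
    using pos assms(3) by (intro frame_insert assms(1)) (auto simp: g_simps field_simps)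
  from frame_card_le[OF this] assms(2) show False by simp
qed

end

subsection \<open>Skew operators\<close>

locale skew_operator = minkowski t for t :: "'d::finite" +
  fixes K :: "real ^ 'd \<Rightarrow> real ^ 'd"
  assumes linear_K: "linear K"
    and skew: "g (K u) v = - g u (K v)"
begin

lemmas K_simps = linear_add[OF linear_K] linear_diff[OF linear_K] linear_neg[OF linear_K]
  linear_scale[OF linear_K] linear_0[OF linear_K]

lemma g_K_self: "g x (K x) = 0" "g (K x) x = 0"
  using skew[of x x] by (simp_all add: g_commute)

lemma continuous_on_K [continuous_intros]:
  "continuous_on S f \<Longrightarrow> continuous_on S (\<lambda>x. K (f x))"
  using continuous_on_compose2[OF linear_continuous_on[OF linear_K[unfolded linear_conv_bounded_linear], of UNIV]]
  by blast

text \<open>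
  The flow of \<open>K\<close> preserves the causal cone, so by Brouwer it should fix a ray of it. Directly: a
  zero of the field that \<open>K\<close> induces on the ball of directions is a fixed point of the step along
  the field followed by the projection onto the ball.
\<close>

lemma causal_eigenvector:
  obtains y l where "y \<noteq> 0" "g y y \<le> 0" "K y = l *\<^sub>R y"
proof -
  define p :: "real ^ 'd" where "p = axis t 1"
  \<comment> \<open>The section of the future causal cone at time component 1.\<close>
  define S where "S = {x. x $ t = 1} \<inter> cball p 1"
  have St: "{x. x $ t = 1} = {x. p \<bullet> x = 1}"
    by (simp add: p_def inner_axis')
  have compact: "compact S" and convex: "convex S"
    unfolding S_def St by (auto intro!: closed_Int_compact closed_hyperplane convex_Int convex_hyperplane)
  have "p \<in> S" by (simp add: S_def p_def)
  then have ne: "S \<noteq> {}" by blast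
  have closed: "closed S" using compact by (rule compact_imp_closed)
  \<comment> \<open>On \<open>S\<close> this is the velocity of the flow of \<open>K\<close> once
    rays are rescaled to time component 1; its zeros are eigenvectors.\<close>
  define X where "X y = K y - (K y $ t) *\<^sub>R y" for y
  define h where "h y = closest_point S (y + X y)" for y
  have contX: "continuous_on S X" unfolding X_def by (intro continuous_intros)
  have "continuous_on S h" unfolding h_def
    by (rule continuous_on_compose2[OF continuous_on_closest_point[OF convex closed ne]])
      (intro continuous_intros contX, auto)
  moreover have "h ` S \<subseteq> S" unfolding h_def using closest_point_in_set[OF closed ne] by auto
  ultimately obtain y where y: "y \<in> S" "h y = y"
    using brouwer[OF compact convex ne] by blast
  define w where "w = y - p"
  have yt: "y $ t = 1" and w1: "norm w \<le> 1"
    using y(1) by (auto simp: S_def w_def dist_norm norm_minus_commute)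
  have Xt: "X y $ t = 0" by (simp add: X_def yt)
  have wt: "w $ t = 0" by (simp add: w_def p_def yt)
  have yy: "g y y = w \<bullet> w - 1"
    using yt by (simp add: g_def w_def p_def inner_diff_left inner_diff_right inner_axis inner_axis')
  have "g y (X y) = - (K y $ t) * g y y" by (simp add: X_def g_simps g_K_self)
  moreover have "g y (X y) = w \<bullet> X y"
    by (simp add: g_def Xt w_def inner_diff_left p_def inner_axis')
  \<comment> \<open>Where \<open>norm w = 1\<close>, this says that the field is tangent to the
    boundary sphere.\<close>
  ultimately have wX: "w \<bullet> X y = - (K y $ t) * (w \<bullet> w - 1)" by (simp add: yy)
  have vi: "X y \<bullet> (x - y) \<le> 0" if "x \<in> S" for x
    using closest_point_dot[OF convex closed that, of "y + X y"] y(2) by (simp add: h_def)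
  \<comment> \<open>The vector \<open>w + X y\<close>, shrunk into the unit ball, serves as test
    point. If \<open>X y\<close> were nonzero, it would give
    \<open>norm (X y) \<le> w \<bullet> X y\<close>; this puts \<open>y\<close> on the boundary,
    where tangency contradicts it.\<close>
  define x where "x = p + (1 / (1 + norm (X y))) *\<^sub>R (w + X y)"
  have pos: "0 < 1 + norm (X y)" by (simp add: add_pos_nonneg)
  have "norm (w + X y) \<le> 1 + norm (X y)" using norm_triangle_ineq[of w "X y"] w1 by simp
  then have "norm ((1 / (1 + norm (X y))) *\<^sub>R (w + X y)) \<le> 1"
    using pos by (simp only: norm_scaleR) (simp add: field_simps)
  moreover have "dist p x = norm ((1 / (1 + norm (X y))) *\<^sub>R (w + X y))"
    unfolding x_def by (metis add_diff_cancel_left' dist_commute dist_norm)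
  ultimately have "x \<in> S"
    by (simp add: S_def) (simp add: x_def p_def wt Xt)
  have xy: "x - y = (1 / (1 + norm (X y))) *\<^sub>R (w + X y) - w"
    unfolding x_def by (simp add: w_def)
  from vi[OF \<open>x \<in> S\<close>] have "(X y \<bullet> (w + X y)) / (1 + norm (X y)) - X y \<bullet> w \<le> 0"
    by (simp only: xy inner_diff_right inner_scaleR_right) simp
  then have "X y \<bullet> (w + X y) \<le> (X y \<bullet> w) * (1 + norm (X y))"
    using pos by (simp add: field_simps)
  then have ineq: "norm (X y) * norm (X y) \<le> norm (X y) * (w \<bullet> X y)"
    by (simp add: inner_add_right algebra_simps power2_norm_eq_inner[symmetric] power2_eq_square
        inner_commute)
  have "X y = 0"
  proof (rule ccontr)
    assume n: "X y \<noteq> 0"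
    with ineq have le: "norm (X y) \<le> w \<bullet> X y" by simp
    also have "\<dots> \<le> norm w * norm (X y)" by (rule norm_cauchy_schwarz)
    finally have "norm w = 1" using n w1 by simp
    then have "w \<bullet> w = 1" by (simp add: norm_eq_1)
    then have "w \<bullet> X y = 0" using wX by simp
    with le n show False by simp
  qed
  then have "K y = (K y $ t) *\<^sub>R y" by (simp add: X_def)
  moreover have "y \<noteq> 0" using yt by auto
  moreover have "g y y \<le> 0"
    using w1 by (simp add: yy power2_norm_eq_inner[symmetric] power_le_one)
  ultimately show thesis using that by blast
qed

text \<open>The Fredholm alternative for a \<open>g\<close>-self-adjoint operator;
  \<open>time_flip\<close> translates it into the Euclidean double complement. It will be applied to
  the square of \<open>K\<close>.\<close>

lemma in_range_if_perp_kernel: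
  fixes T :: "real ^ 'd \<Rightarrow> real ^ 'd"
  assumes T: "linear T" and adj: "\<And>u w. g (T u) w = g u (T w)"
    and ker: "\<And>x. T x = 0 \<Longrightarrow> g x v = 0"
  shows "v \<in> range T"
proof -
  have sub: "subspace (range T)" using T by (simp add: linear_subspace_image)
  have "orthogonal x v" if x: "x \<in> (range T)\<^sup>\<bottom>" for x
  proof -
    have "g (time_flip x) (T w) = 0" for w
      using x by (auto simp: orthogonal_comp_def orthogonal_def inner_time_flip(1)[symmetric] inner_commute)
    then have "T (time_flip x) = 0" by (intro g_nondegenerate) (simp add: adj)
    from ker[OF this] show ?thesis
      by (simp add: orthogonal_def inner_time_flip(1)[symmetric])
  qed
  then have "v \<in> (range T)\<^sup>\<bottom>\<^sup>\<bottom>"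
    by (auto simp: orthogonal_comp_def orthogonal_commute)
  then show ?thesis by (simp add: orthogonal_comp_self[OF sub])
qed

section \<open>Invariant Lorentzian blocks\<close>

text \<open>\<open>m\<close> is the last index of the block, whose dimension is
  \<open>m + 1\<close>. In the third alternative \<open>K\<close> is nilpotent of order three and
  kills the null vector \<open>e 0 + e 2\<close>.\<close>

definition lorentz_block :: "nat \<Rightarrow> real \<Rightarrow> (nat \<Rightarrow> real ^ 'd) \<Rightarrow> bool" where
  "lorentz_block m a e \<longleftrightarrow>
    m = 0 \<and> K (e 0) = 0 \<or>
    m = 1 \<and> 0 < a \<and> K (e 0) = a *\<^sub>R e 1 \<and> K (e 1) = a *\<^sub>R e 0 \<or>
    m = 2 \<and> K (e 0) = e 1 \<and> K (e 1) = e 0 + e 2 \<and> K (e 2) = - e 1"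

lemma timelike_kernel_block:
  assumes "g v v < 0" "K v = 0"
  obtains e where "frame {0..0} e" "lorentz_block 0 0 e"
proof -
  define e :: "nat \<Rightarrow> real ^ 'd" where "e j = (1 / sqrt (- g v v)) *\<^sub>R v" for j
  have "frame {0..0} e" using assms by (simp add: frame_def e_def g_simps field_simps)
  moreover have "lorentz_block 0 0 e" by (simp add: lorentz_block_def e_def K_simps assms)
  ultimately show thesis by (rule that)
qed

text \<open>By skewness the range of \<open>K + l\<close> is orthogonal to \<open>y\<close>, so
  \<open>- l\<close> is an eigenvalue too. Both eigenvectors are null and together span a Lorentzian
  plane.\<close>

lemma null_eigenvector_block:
  assumes "K y = l *\<^sub>R y" "l \<noteq> 0" "y \<noteq> 0"
  obtains a e where "frame {0..1} e" "lorentz_block 1 a e"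
proof -
  have yy: "g y y = 0" using g_K_self(1)[of y] assms by (simp add: g_simps)
  define T where "T x = K x + l *\<^sub>R x" for x
  have lin: "linear T" unfolding T_def using linear_K
    by (intro linear_compose_add linear_scaleR) auto
  have "\<not> inj T"
  proof
    assume "inj T"
    then have "surj T" using linear_injective_imp_surjective[OF lin] by simp
    have "g y z = 0" for z
    proof -
      obtain x where "z = T x" using \<open>surj T\<close> by (rule surjE)
      then show ?thesis using skew[of y x] assms by (simp add: T_def g_simps)
    qed
    then show False using g_nondegenerate assms(3) by blast
  qed
  then obtain u where u: "u \<noteq> 0" "T u = 0" using linear_injective_0[OF lin] by blast
  then have Ku: "K u = - l *\<^sub>R u" by (simp add: T_def eq_neg_iff_add_eq_0)
  have uu: "g u u = 0" using g_K_self(1)[of u] assms(2) by (simp add: Ku g_simps)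
  have yu: "g y u \<noteq> 0"
  proof
    assume "g y u = 0"
    from null_perp[OF yy assms(3) this] uu obtain c where c: "u = c *\<^sub>R y" by auto
    then have "K u = l *\<^sub>R u" using assms(1) by (simp add: K_simps)
    with Ku have "(l + l) *\<^sub>R u = 0" unfolding scaleR_left_distrib by simp
    then show False using u(1) assms(2) by simp
  qed
  \<comment> \<open>As \<open>y\<close> and \<open>u\<close> are null, only \<open>g y u\<close>
    enters the squares of \<open>y - q *\<^sub>R u\<close> and \<open>y + q *\<^sub>R u\<close>;
    this \<open>q\<close> makes them -1 and 1. The sign of \<open>l\<close> goes into
    \<open>e 1\<close>, so that the boost coefficient is positive.\<close>
  define q where "q = 1 / (2 * g y u)"
  define s where "s = sgn l"
  have s: "s * s = 1" "s * l = \<bar>l\<bar>" using assms(2) by (auto simp: s_def sgn_if)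
  define e where "e j = (if j = 0 then y - q *\<^sub>R u else s *\<^sub>R (y + q *\<^sub>R u))" for j :: nat
  have "frame {0..1} e"
    using yy uu yu s(1) mult.assoc[of s s]
    by (auto simp: frame_def e_def g_simps q_def g_commute[of u y])
  moreover have "K (e 0) = \<bar>l\<bar> *\<^sub>R e 1" "K (e 1) = \<bar>l\<bar> *\<^sub>R e 0"
    using s by (simp_all add: e_def K_simps Ku assms(1) algebra_simps s_def sgn_if)
  then have "lorentz_block 1 \<bar>l\<bar> e" using assms(2) by (simp add: lorentz_block_def)
  ultimately show thesis by (rule that)
qed

text \<open>Without timelike vectors in the kernel, its null vectors form a line that is orthogonal
  to the whole kernel. This makes \<open>y\<close> orthogonal to the kernel of the square of
  \<open>K\<close>, hence \<open>y = K (K u)\<close>, and \<open>u\<close>, \<open>K u\<close>,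
  \<open>y\<close> span the block.\<close>

lemma null_kernel_block:
  assumes y: "K y = 0" "y \<noteq> 0" "g y y = 0" and nt: "\<And>v. K v = 0 \<Longrightarrow> 0 \<le> g v v"
  obtains e where "frame {0..2} e" "lorentz_block 2 0 e"
proof -
  have par: "\<exists>c. x = c *\<^sub>R y" if x: "K x = 0" "g x x = 0" for x
  proof (cases "g y x = 0")
    case True
    with null_perp[OF y(3,2) True] x(2) show ?thesis by auto
  next
    case False
    \<comment> \<open>For null \<open>x\<close> and \<open>y\<close> the right-hand side equals
      -2.\<close>
    have "0 \<le> g (x - (1 / g y x) *\<^sub>R y) (x - (1 / g y x) *\<^sub>R y)"
      using x y by (intro nt) (simp add: K_simps)
    then show ?thesis using False x(2) y(3) by (simp add: g_simps g_commute[of x y])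
  qed
  have "y \<in> range (\<lambda>x. K (K x))"
  proof (rule in_range_if_perp_kernel)
    show "linear (\<lambda>x. K (K x))" using linear_compose[OF linear_K linear_K] by (simp add: o_def)
    show "g (K (K u)) w = g u (K (K w))" for u w using skew by simp
    fix x assume x: "K (K x) = 0"
    have "g (K x) (K x) = 0" using skew[of x "K x"] x by (simp add: g_simps)
    from par[OF x this] obtain c where c: "K x = c *\<^sub>R y" by blast
    show "g x y = 0"
    proof (cases "c = 0")
      case True
      then have Kx: "K x = 0" using c by simp
      show ?thesis
      proof (rule ccontr)
        assume n: "g x y \<noteq> 0"
        \<comment> \<open>The solution of \<open>g x x + 2 * k * g x y = - 1\<close>, which would be
          the square of a timelike kernel vector.\<close>
        define k where "k = - (g x x + 1) / (2 * g x y)"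
        have "K (x + k *\<^sub>R y) = 0" by (simp add: K_simps Kx y)
        moreover have "g (x + k *\<^sub>R y) (x + k *\<^sub>R y) = - 1"
          using n y by (simp add: g_simps g_commute[of y x] k_def field_simps)
        ultimately show False using nt[of "x + k *\<^sub>R y"] by simp
      qed
    next
      case False
      have "c * g x y = 0" using g_K_self(1)[of x] by (simp add: c g_simps)
      with False show ?thesis by simp
    qed
  qed
  then obtain u where u: "K (K u) = y" by auto
  define q where "q = g (K u) (K u)"
  have uy: "g u y = - q" using skew[of u "K u"] by (simp add: q_def u)
  have "g y (K u) = 0" using skew[of y u] y by (simp add: g_simps)
  moreover have "K u \<noteq> c *\<^sub>R y" for c
  proof
    assume "K u = c *\<^sub>R y"
    then have "K (K u) = 0" by (simp add: K_simps y)
    then show False using u y by simp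
  qed
  ultimately have "0 < q"
    using null_perp[OF y(3,2), of "K u"] by (auto simp: q_def)
  \<comment> \<open>\<open>c\<close> normalises \<open>K u\<close>, whose square is
    \<open>q\<close>. Adding \<open>s *\<^sub>R y\<close> does not affect the image under
    \<open>K\<close> and changes the square of \<open>u\<close> to \<open>- q\<close>.\<close>
  define c where "c = 1 / sqrt q"
  have cc: "c * c * q = 1" using \<open>0 < q\<close> by (simp add: c_def)
  define s where "s = (g u u + q) / (2 * q)"
  define e0 where "e0 = c *\<^sub>R (u + s *\<^sub>R y)"
  have K3: "K (K (K e0)) = 0" and KK: "K (K e0) = c *\<^sub>R y"
    by (simp_all add: e0_def K_simps u y)
  have g0: "g e0 e0 = - 1"
  proof -
    have "g e0 e0 = c * c * (g u u - 2 * s * q)"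
      by (simp add: e0_def g_simps y uy g_commute[of y u] algebra_simps)
    also have "g u u - 2 * s * q = - q" using \<open>0 < q\<close> by (simp add: s_def field_simps)
    finally show ?thesis using cc by simp
  qed
  have g02: "g e0 (K (K e0)) = - 1"
    unfolding KK using cc by (simp add: e0_def g_simps y uy algebra_simps)
  have g11: "g (K e0) (K e0) = 1" using skew[of e0 "K e0"] g02 by simp
  have g22: "g (K (K e0)) (K (K e0)) = 0" by (simp add: KK g_simps y)
  \<comment> \<open>\<open>K (K e0)\<close> is null and pairs with \<open>e0\<close> to -1, so
    subtracting \<open>e0\<close> leaves a unit spacelike vector orthogonal to
    \<open>e0\<close>.\<close>
  define e where "e j = (if j = 0 then e0 else if j = 1 then K e0 else K (K e0) - e0)" for j :: nat
  have "{0..2} = {0, 1, 2::nat}" by auto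
  then have "frame {0..2} e"
    using g0 g02 g11 g22 g_K_self g_commute[of "K (K e0)" e0]
    by (simp add: frame_def e_def g_simps)
  moreover have "lorentz_block 2 0 e"
    by (simp add: lorentz_block_def e_def K_simps K3)
  ultimately show thesis by (rule that)
qed

lemma exists_lorentz_block:
  obtains m a e where "frame {0..m} e" "lorentz_block m a e"
proof -
  obtain y l where y: "y \<noteq> 0" "g y y \<le> 0" "K y = l *\<^sub>R y" by (rule causal_eigenvector)
  \<comment> \<open>The cases inspect the whole kernel and not just \<open>y\<close>: if it has no
    timelike vector and \<open>l = 0\<close>, then \<open>y\<close> itself must be null.\<close>
  consider v where "g v v < 0" "K v = 0" | "l \<noteq> 0" | "l = 0" "\<And>v. K v = 0 \<Longrightarrow> 0 \<le> g v v"
    by (metis not_less)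
  then show thesis
  proof cases
    case 1
    then show ?thesis by (rule timelike_kernel_block) (rule that)
  next
    case 2
    show ?thesis by (rule null_eigenvector_block[OF y(3) 2 y(1)]) (rule that)
  next
    case 3
    have "K y = 0" using y(3) 3(1) by simp
    moreover from this have "g y y = 0" using 3(2) y(2) by fastforce
    ultimately show ?thesis by (rule null_kernel_block[OF _ y(1) _ 3(2)]) (assumption, rule that)
  qed
qed

subsection \<open>Rotation planes\<close>

text \<open>
  The maximiser of the quotient \<open>g (K z) (K z) / g z z\<close> spans together with its image an invariant
  plane. Choosing planes greedily in this way makes the rotation coefficients decrease.
\<close>

lemma exists_rotation_plane:
  assumes sub: "subspace C" and pos: "\<And>z. z \<in> C \<Longrightarrow> z \<noteq> 0 \<Longrightarrow> 0 < g z z"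
    and inv: "\<And>z. z \<in> C \<Longrightarrow> K z \<in> C" and nz: "z0 \<in> C" "K z0 \<noteq> 0"
  obtains x y b where "0 < b" "x \<in> C" "y \<in> C" "g x x = 1" "g y y = 1" "g x y = 0"
    "K x = b *\<^sub>R y" "K y = (- b) *\<^sub>R x" "\<And>z. z \<in> C \<Longrightarrow> g (K z) (K z) \<le> b\<^sup>2 * g z z"
proof -
  \<comment> \<open>The Euclidean sphere supplies compactness; homogeneity of \<open>h\<close>
    carries the maximum over to all of \<open>C\<close>.\<close>
  define S where "S = C \<inter> sphere 0 1"
  define h where "h z = g (K z) (K z) / g z z" for z
  have unit: "(1 / norm z) *\<^sub>R z \<in> S" if "z \<in> C" "z \<noteq> 0" for z
    using that sub by (simp add: S_def subspace_scale)
  have h_scale: "h (c *\<^sub>R z) = h z" if "c \<noteq> 0" for c z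
    using that by (simp add: h_def K_simps g_simps)
  have Spos: "0 < g z z" if "z \<in> S" for z using that by (intro pos) (auto simp: S_def)
  have "compact S" unfolding S_def using closed_subspace[OF sub] by (intro closed_Int_compact) auto
  moreover have "z0 \<noteq> 0" using nz by (auto simp: K_simps)
  then have "S \<noteq> {}" using unit nz by blast
  moreover have "continuous_on S h" unfolding h_def
    using Spos by (intro continuous_intros) force
  ultimately obtain u where u: "u \<in> S" "\<And>z. z \<in> S \<Longrightarrow> h z \<le> h u"
    using continuous_attains_sup by metis
  define x where "x = (1 / sqrt (g u u)) *\<^sub>R u"
  have uC: "u \<in> C" using u(1) by (simp add: S_def)
  have xC: "x \<in> C" using uC sub by (simp add: x_def subspace_scale)
  have xx: "g x x = 1" using Spos[OF u(1)] by (simp add: x_def g_simps)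
  have hx: "h x = h u" using Spos[OF u(1)] by (simp add: x_def h_scale)
  have max: "h z \<le> h x" if "z \<in> C" "z \<noteq> 0" for z
    using u(2)[OF unit[OF that]] h_scale[of "1 / norm z" z] that hx by simp
  have nonneg: "0 \<le> g z z" if "z \<in> C" for z
    using pos[OF that] by (cases "z = 0") (auto simp: g_simps less_imp_le)
  have "0 < h z0" using nz \<open>z0 \<noteq> 0\<close> pos inv by (simp add: h_def)
  then have "0 < h x" using max[OF nz(1) \<open>z0 \<noteq> 0\<close>] by simp
  define b where "b = sqrt (h x)"
  have b: "0 < b" "b\<^sup>2 = h x" using \<open>0 < h x\<close> by (auto simp: b_def)
  have bound: "g (K z) (K z) \<le> b\<^sup>2 * g z z" if "z \<in> C" for z
  proof (cases "z = 0")
    case False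
    have "g (K z) (K z) = h z * g z z" using pos[OF that False] by (simp add: h_def)
    also have "\<dots> \<le> h x * g z z" using max[OF that False] nonneg[OF that] by (intro mult_right_mono)
    finally show ?thesis by (simp add: b)
  qed (simp add: K_simps g_simps)
  have KxKx: "g (K x) (K x) = b\<^sup>2" by (simp add: b h_def xx)
  \<comment> \<open>Up to a factor, the gradient at \<open>x\<close> of
    \<open>b\<^sup>2 * g z z - g (K z) (K z)\<close>, which on \<open>C\<close> attains its minimum
    0 there.\<close>
  define w where "w = b\<^sup>2 *\<^sub>R x + K (K x)"
  have wC: "w \<in> C" unfolding w_def using xC by (intro subspace_add[OF sub] subspace_scale[OF sub] inv)
  have "g w z = 0" if "z \<in> C" for z
  proof (rule linear_coeff_zero)
    fix s :: real
    have "x + s *\<^sub>R z \<in> C" using sub xC that by (intro subspace_add subspace_scale)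
    from bound[OF this] have "0 \<le> b\<^sup>2 * (1 + 2 * s * g x z + s * s * g z z)
        - (b\<^sup>2 + 2 * s * g (K x) (K z) + s * s * g (K z) (K z))"
      by (simp add: K_simps g_simps xx KxKx g_commute[of z x] g_commute[of "K z" "K x"] algebra_simps)
    then show "0 \<le> 2 * s * g w z + s * s * (b\<^sup>2 * g z z - g (K z) (K z))"
      using skew[of "K x" z] by (simp add: w_def g_simps algebra_simps)
  qed
  from this[OF wC] have "w = 0" using pos[OF wC] by force
  then have KKx: "K (K x) = (- b\<^sup>2) *\<^sub>R x" by (simp add: w_def eq_neg_iff_add_eq_0 add.commute)
  define y where "y = (1 / b) *\<^sub>R K x"
  show thesis
  proof (rule that[OF b(1) xC _ xx])
    show "y \<in> C" unfolding y_def using sub inv xC by (intro subspace_scale)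
    show "g y y = 1" using b(1) by (simp add: y_def g_simps KxKx power2_eq_square)
    show "g x y = 0" by (simp add: y_def g_simps g_K_self)
    show "K x = b *\<^sub>R y" using b(1) by (simp add: y_def)
    show "K y = (- b) *\<^sub>R x" using b(1) by (simp add: y_def K_simps KKx power2_eq_square)
  qed (rule bound)
qed

definition rotation_block :: "nat \<Rightarrow> nat \<Rightarrow> (nat \<Rightarrow> real) \<Rightarrow> (nat \<Rightarrow> real ^ 'd) \<Rightarrow> bool" where
  "rotation_block m r b e \<longleftrightarrow>
    (\<forall>i\<in>{1..r}. 0 < b i \<and> K (e (m + 2 * i - 1)) = b i *\<^sub>R e (m + 2 * i) \<and>
      K (e (m + 2 * i)) = (- b i) *\<^sub>R e (m + 2 * i - 1))"

lemma block_index_cases: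
  fixes j m r :: nat
  assumes "j \<le> m + 2 * r"
  obtains "j \<le> m" | i where "i \<in> {1..r}" "j = m + 2 * i - 1" | i where "i \<in> {1..r}" "j = m + 2 * i"
proof -
  define k where "k = j - m"
  consider "j \<le> m" | "m < j" "even k" | "m < j" "odd k" by linarith
  then show thesis
  proof cases
    case 2
    then obtain i where "k = 2 * i" by blast
    then show thesis using 2 assms that(3)[of i] by (auto simp: k_def)
  next
    case 3
    then obtain i where "k = 2 * i + 1" using oddE by blast
    then show thesis using 3 assms that(2)[of "i + 1"] by (auto simp: k_def)
  qed (rule that)
qed

lemma K_in_span_frame:
  assumes lor: "\<And>j. j \<le> m \<Longrightarrow> K (e j) \<in> span (e ` {0..m})" and rot: "rotation_block m r b e"
    and j: "j \<le> m + 2 * r"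
  shows "K (e j) \<in> span (e ` {0..m + 2 * r})"
proof -
  have mem: "c *\<^sub>R e k \<in> span (e ` {0..m + 2 * r})" if "k \<le> m + 2 * r" for c k
    using that by (intro span_scale span_base) auto
  from j show ?thesis
  proof (cases rule: block_index_cases)
    case 1
    have "span (e ` {0..m}) \<subseteq> span (e ` {0..m + 2 * r})" by (intro span_mono) auto
    then show ?thesis using lor[OF 1] by blast
  next
    case (2 i)
    then have "K (e j) = b i *\<^sub>R e (m + 2 * i)" using rot by (simp add: rotation_block_def)
    then show ?thesis using mem[of "m + 2 * i" "b i"] 2 by auto
  next
    case (3 i)
    then have "K (e j) = (- b i) *\<^sub>R e (m + 2 * i - 1)" using rot by (simp add: rotation_block_def)
    then show ?thesis using mem[of "m + 2 * i - 1" "- b i"] 3 by auto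
  qed
qed

definition perp :: "nat set \<Rightarrow> (nat \<Rightarrow> real ^ 'd) \<Rightarrow> (real ^ 'd) set" where
  "perp I e = {z. \<forall>j\<in>I. g (e j) z = 0}"

lemma frame_in_perp:
  assumes "frame I f" "k \<in> I" "J \<subseteq> I" "k \<notin> J" "\<And>j. j \<in> J \<Longrightarrow> f j = e j"
  shows "f k \<in> perp J e"
  unfolding perp_def
proof safe
  fix j assume "j \<in> J"
  then have "j \<in> I" "j \<noteq> k" "f j = e j" using assms(3-5) by auto
  then show "g (e j) (f k) = 0" using frameD[OF assms(1), of j k] assms(2) by simp
qed

lemma subspace_perp: "subspace (perp I e)"
  by (auto simp: subspace_def perp_def g_simps)

lemma perp_span:
  assumes "z \<in> perp I e" "y \<in> span (e ` I)"
  shows "g y z = 0"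
proof -
  have "subspace {y. g y z = 0}" by (auto simp: subspace_def g_simps)
  moreover have "e ` I \<subseteq> {y. g y z = 0}" using assms(1) by (auto simp: perp_def)
  ultimately show ?thesis using assms(2) span_minimal by blast
qed

lemma K_perp:
  assumes "\<And>j. j \<in> I \<Longrightarrow> K (e j) \<in> span (e ` I)" "z \<in> perp I e"
  shows "K z \<in> perp I e"
  unfolding perp_def
proof safe
  fix j assume "j \<in> I"
  from perp_span[OF assms(2) assms(1)[OF this]] show "g (e j) (K z) = 0"
    using skew[of "e j" z] by simp
qed

text \<open>\<open>bound\<close> remembers that \<open>b r\<close> was maximal on the present
  complement. The new coefficient is attained there, hence is at most \<open>b r\<close>, and its
  own bound passes to the smaller complement. Before the first plane there is no \<open>b r\<close>,
  whence the guard \<open>1 \<le> r\<close>.\<close>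

lemma rotation_step:
  assumes lor: "\<And>j. j \<le> m \<Longrightarrow> K (e j) \<in> span (e ` {0..m})"
    and fr: "frame {0..m + 2 * r} e" and rot: "rotation_block m r b e" and mono: "antimono_on {1..r} b"
    and bound: "\<And>z. 1 \<le> r \<Longrightarrow> z \<in> perp {0..m + 2 * r} e \<Longrightarrow> g (K z) (K z) \<le> (b r)\<^sup>2 * g z z"
    and nz: "z0 \<in> perp {0..m + 2 * r} e" "K z0 \<noteq> 0"
  obtains e' b' where "\<And>j. j \<le> m \<Longrightarrow> e' j = e j" "frame {0..m + 2 * Suc r} e'"
    "rotation_block m (Suc r) b' e'" "antimono_on {1..Suc r} b'"
    "\<And>z. z \<in> perp {0..m + 2 * Suc r} e' \<Longrightarrow> g (K z) (K z) \<le> (b' (Suc r))\<^sup>2 * g z z"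
proof -
  define N where "N = m + 2 * r"
  define C where "C = perp {0..N} e"
  have C: "g (e j) z = 0" if "z \<in> C" "j \<le> N" for z j using that by (simp add: C_def perp_def)
  obtain x y c where xy: "0 < c" "x \<in> C" "y \<in> C" "g x x = 1" "g y y = 1" "g x y = 0"
    "K x = c *\<^sub>R y" "K y = (- c) *\<^sub>R x" "\<And>z. z \<in> C \<Longrightarrow> g (K z) (K z) \<le> c\<^sup>2 * g z z"
  proof (rule exists_rotation_plane[of C z0])
    show "subspace C" by (simp add: C_def subspace_perp)
    show "0 < g z z" if "z \<in> C" "z \<noteq> 0" for z
      using frame_perp_pos[OF fr _ _ that(2)] C[OF that(1)] by (auto simp: N_def)
    show "K z \<in> C" if "z \<in> C" for z
      using that K_in_span_frame[OF lor rot] unfolding C_def N_def by (intro K_perp) auto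
    show "z0 \<in> C" "K z0 \<noteq> 0" using nz by (simp_all add: C_def N_def)
  qed (blast intro: that)
  define e1 where "e1 = e(N + 1 := x)"
  define e' where "e' = e1(N + 2 := y)"
  define b' where "b' = b(Suc r := c)"
  have "frame (insert (N + 1) {0..N}) e1"
    unfolding e1_def using fr C[OF xy(2)] xy(4) by (intro frame_insert) (auto simp: N_def)
  then have "frame (insert (N + 2) (insert (N + 1) {0..N})) e'"
    unfolding e'_def using C[OF xy(3)] xy(5,6)
    by (intro frame_insert) (auto simp: e1_def)
  also have "insert (N + 2) (insert (N + 1) {0..N}) = {0..m + 2 * Suc r}"
    by (auto simp: N_def)
  finally have fr': "frame {0..m + 2 * Suc r} e'" .
  have e'_old: "e' j = e j" if "j \<le> N" for j using that by (simp add: e'_def e1_def)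
  have e'_new: "e' (N + 1) = x" "e' (N + 2) = y" by (simp_all add: e'_def e1_def)
  have rot': "rotation_block m (Suc r) b' e'"
    unfolding rotation_block_def
  proof
    fix i assume i: "i \<in> {1..Suc r}"
    show "0 < b' i \<and> K (e' (m + 2 * i - 1)) = b' i *\<^sub>R e' (m + 2 * i) \<and>
      K (e' (m + 2 * i)) = (- b' i) *\<^sub>R e' (m + 2 * i - 1)"
    proof (cases "i = Suc r")
      case True
      then have "m + 2 * i - 1 = N + 1" "m + 2 * i = N + 2" by (auto simp: N_def)
      then show ?thesis using True xy e'_new by (simp add: b'_def)
    next
      case False
      then have "e' (m + 2 * i - 1) = e (m + 2 * i - 1)" "e' (m + 2 * i) = e (m + 2 * i)" "b' i = b i"
        using i by (auto simp: N_def b'_def intro!: e'_old)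
      moreover have "i \<in> {1..r}" using i False by auto
      ultimately show ?thesis using rot by (simp add: rotation_block_def)
    qed
  qed
  have last: "c \<le> b r" if "1 \<le> r"
  proof -
    have "c\<^sup>2 = g (K x) (K x)" using xy by (simp add: g_simps power2_eq_square)
    also have "\<dots> \<le> (b r)\<^sup>2" using bound[OF that, of x] xy by (simp add: C_def N_def)
    finally have "c\<^sup>2 \<le> (b r)\<^sup>2" .
    moreover have "0 < b r" using rot that by (auto simp: rotation_block_def)
    ultimately show ?thesis using power2_le_imp_le[of c "b r"] by simp
  qed
  have mono': "antimono_on {1..Suc r} b'"
  proof (rule monotone_onI)
    fix i j assume ij: "i \<in> {1..Suc r}" "j \<in> {1..Suc r}" "i \<le> j"
    have old: "b k \<le> b i" if "i \<le> k" "k \<le> r" for k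
      using mono that ij by (auto simp: monotone_on_def)
    show "b' j \<le> b' i"
      using ij old[of j] old[of r] last by (cases "j = Suc r"; cases "i = Suc r") (auto simp: b'_def)
  qed
  have bound': "g (K z) (K z) \<le> (b' (Suc r))\<^sup>2 * g z z" if "z \<in> perp {0..m + 2 * Suc r} e'" for z
  proof -
    have "z \<in> C" unfolding C_def perp_def
    proof safe
      fix j assume "j \<in> {0..N}"
      then have "j \<le> N" "j \<in> {0..m + 2 * Suc r}" by (simp_all add: N_def)
      then show "g (e j) z = 0" using that e'_old[of j] unfolding perp_def by fastforce
    qed
    then show ?thesis using xy(9) by (simp add: b'_def)
  qed
  show thesis
    by (rule that[OF _ fr' rot' mono' bound']) (auto simp: e'_old N_def)
qed

text \<open>If \<open>K\<close> never vanished on the complement, planes could be split off forever,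
  and \<open>CARD('d)\<close> of them give too large a frame.\<close>

lemma exists_rotation_block:
  assumes lor: "\<And>j. j \<le> m \<Longrightarrow> K (e j) \<in> span (e ` {0..m})" and fr: "frame {0..m} e"
  obtains r b e' where "\<And>j. j \<le> m \<Longrightarrow> e' j = e j" "frame {0..m + 2 * r} e'"
    "rotation_block m r b e'" "antimono_on {1..r} b"
    "\<And>z. z \<in> perp {0..m + 2 * r} e' \<Longrightarrow> K z = 0"
proof (rule ccontr)
  assume no: "\<not> thesis"
  note found = that
  have "\<exists>b e'. (\<forall>j\<le>m. e' j = e j) \<and> frame {0..m + 2 * r} e' \<and> rotation_block m r b e' \<and>
    antimono_on {1..r} b \<and>
    (1 \<le> r \<longrightarrow> (\<forall>z\<in>perp {0..m + 2 * r} e'. g (K z) (K z) \<le> (b r)\<^sup>2 * g z z))" for r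
  proof (induction r)
    case 0
    then show ?case using fr by (auto simp: rotation_block_def monotone_on_def)
  next
    case (Suc r)
    then obtain b e' where IH: "\<And>j. j \<le> m \<Longrightarrow> e' j = e j" "frame {0..m + 2 * r} e'"
      "rotation_block m r b e'" "antimono_on {1..r} b"
      "\<And>z. 1 \<le> r \<Longrightarrow> z \<in> perp {0..m + 2 * r} e' \<Longrightarrow> g (K z) (K z) \<le> (b r)\<^sup>2 * g z z"
      by auto
    have im: "e' ` {0..m} = e ` {0..m}" using IH(1) by (intro image_cong) auto
    have lor': "K (e' j) \<in> span (e' ` {0..m})" if "j \<le> m" for j
      using lor[OF that] IH(1)[OF that] by (simp add: im)
    obtain z0 where "z0 \<in> perp {0..m + 2 * r} e'" "K z0 \<noteq> 0"
      using found[OF IH(1-4)] no by blast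
    from rotation_step[OF lor' IH(2-5) this] obtain e'' b'' where
      "\<And>j. j \<le> m \<Longrightarrow> e'' j = e' j" "frame {0..m + 2 * Suc r} e''"
      "rotation_block m (Suc r) b'' e''" "antimono_on {1..Suc r} b''"
      "\<And>z. z \<in> perp {0..m + 2 * Suc r} e'' \<Longrightarrow> g (K z) (K z) \<le> (b'' (Suc r))\<^sup>2 * g z z"
      by blast
    then show ?case using IH(1) by (intro exI[of _ b''] exI[of _ e'']) auto
  qed
  then obtain e' where "frame {0..m + 2 * CARD('d)} e'" by blast
  from frame_card_le[OF this] show False by simp
qed

end

subsection \<open>Normal forms\<close>

locale killing_field = skew_operator "\<iota> 0" K
  for \<iota> :: "nat \<Rightarrow> 'd::finite" and K :: "real ^ 'd \<Rightarrow> real ^ 'd" +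
  fixes n :: nat and \<phi> :: "real ^ 'd" and \<xi> :: "real ^ 'd \<Rightarrow> real ^ 'd"
  assumes n: "1 \<le> n" and bij: "bij_betw \<iota> {0..n} UNIV"
    and \<xi>: "\<xi> y = time_flip (K y + \<phi>)" and nonzero: "\<xi> \<noteq> (\<lambda>x. 0)"
begin

lemma card_index: "CARD('d) = n + 1"
  using bij_betw_same_card[OF bij] by simp

lemma sum_index: "(\<Sum>j\<in>UNIV. f j) = (\<Sum>k=0..n. f (\<iota> k))"
  using sum.reindex_bij_betw[OF bij] by metis

lemma index_eq_iff: "j \<le> n \<Longrightarrow> k \<le> n \<Longrightarrow> \<iota> j = \<iota> k \<longleftrightarrow> j = k"
  using bij by (auto simp: bij_betw_def inj_on_def)

lemma index_cases: obtains k where "k \<le> n" "j = \<iota> k"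
proof -
  have "j \<in> \<iota> ` {0..n}" using bij by (simp add: bij_betw_def)
  then show thesis using that by auto
qed

lemma vec_eq_index: "x = y \<longleftrightarrow> (\<forall>k\<le>n. x $ \<iota> k = y $ \<iota> k)"
  unfolding vec_eq_iff by (metis index_cases)

lemma metric_mult: "minkowski_metric (\<iota> 0) *v v = time_flip v"
proof -
  have "(\<Sum>j\<in>UNIV. (if i = j then if i = \<iota> 0 then - 1 else 1 else 0) * v $ j)
      = (if i = \<iota> 0 then - 1 else 1) * v $ i" for i
    by (simp add: if_distrib[of "\<lambda>x. x * _"] cong: if_cong)
  then show ?thesis
    by (simp add: vec_eq_iff matrix_vector_mult_def minkowski_metric_def time_flip_def axis_def)
qed

text \<open>The columns are the frame vectors, so this matrix takes new coordinates to old ones; the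
  \<Lambda> of the theorem is its inverse.\<close>

definition frame_matrix :: "(nat \<Rightarrow> real ^ 'd) \<Rightarrow> real ^ 'd ^ 'd" where
  "frame_matrix e = (\<chi> i j. e (inv_into {0..n} \<iota> j) $ i)"

lemma frame_matrix_index: "k \<le> n \<Longrightarrow> frame_matrix e $ i $ \<iota> k = e k $ i"
  using bij by (simp add: frame_matrix_def bij_betw_def inv_into_f_f)

lemma frame_matrix_mult: "frame_matrix e *v x = (\<Sum>k=0..n. x $ \<iota> k *\<^sub>R e k)"
  by (simp add: vec_eq_iff matrix_vector_mult_def sum_index frame_matrix_index mult.commute)

lemma transpose_frame_matrix_mult:
  "k \<le> n \<Longrightarrow> (transpose (frame_matrix e) *v y) $ \<iota> k = e k \<bullet> y"
  by (simp add: matrix_vector_mult_def transpose_def frame_matrix_index inner_vec_def)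

lemma frame_matrix_lorentz:
  assumes "frame {0..n} e"
  shows "frame_matrix e \<in> lorentz_group (\<iota> 0)"
proof -
  let ?M = "frame_matrix e" and ?\<eta> = "minkowski_metric (\<iota> 0)"
  have "(transpose ?M ** ?\<eta> ** ?M) $ i $ j = ?\<eta> $ i $ j" for i j
  proof -
    obtain k l where k: "k \<le> n" "i = \<iota> k" and l: "l \<le> n" "j = \<iota> l" by (metis index_cases)
    have "?M *v axis (\<iota> l) 1 = e l"
      by (simp add: matrix_vector_mult_basis column_def frame_matrix_index[OF l(1)])
    then have "((transpose ?M ** ?\<eta> ** ?M) *v axis (\<iota> l) 1) $ \<iota> k = g (e k) (e l)"
      by (simp add: matrix_vector_mul_assoc[symmetric] metric_mult transpose_frame_matrix_mult[OF k(1)]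
          inner_time_flip del: transpose_matrix_vector)
    moreover have "g (e k) (e l) = ?\<eta> $ i $ j"
      using frameD[OF assms, of k l] k l index_eq_iff[of _ 0] index_eq_iff[of k l]
      by (auto simp: minkowski_metric_def)
    ultimately show ?thesis using k l
      by (simp add: matrix_vector_mult_basis column_def)
  qed
  then show ?thesis by (simp add: lorentz_group_def vec_eq_iff)
qed

text \<open>The inverse is the transpose conjugated by the metric.\<close>

lemma lorentz_inverse:
  assumes M: "M \<in> lorentz_group (\<iota> 0)"
  obtains \<Lambda> where "\<Lambda> \<in> lorentz_group (\<iota> 0)" "M ** \<Lambda> = mat 1"
proof -
  let ?\<eta> = "minkowski_metric (\<iota> 0)"
  have MM: "transpose M ** ?\<eta> ** M = ?\<eta>" using M by (simp add: lorentz_group_def)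
  have "?\<eta> ** ?\<eta> = mat 1"
    unfolding matrix_eq by (simp add: matrix_vector_mul_assoc[symmetric] metric_mult)
  then have "(?\<eta> ** transpose M ** ?\<eta>) ** M = mat 1"
    using MM by (metis matrix_mul_assoc)
  then have inv: "M ** (?\<eta> ** transpose M ** ?\<eta>) = mat 1" (is "M ** ?\<Lambda> = _")
    by (simp add: matrix_left_right_inverse)
  have "transpose ?\<Lambda> ** ?\<eta> ** ?\<Lambda> = transpose ?\<Lambda> ** (transpose M ** ?\<eta> ** M) ** ?\<Lambda>"
    by (simp only: MM)
  also have "\<dots> = transpose (M ** ?\<Lambda>) ** ?\<eta> ** (M ** ?\<Lambda>)"
    by (simp only: matrix_transpose_mul matrix_mul_assoc)
  also have "\<dots> = ?\<eta>" by (simp only: inv transpose_mat matrix_mul_lid matrix_mul_rid)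
  finally have "?\<Lambda> \<in> lorentz_group (\<iota> 0)" by (simp add: lorentz_group_def)
  then show thesis using inv by (rule that)
qed

text \<open>These are the covariant components in the frame: no sign enters the contraction with
  \<open>e j\<close>, and so \<open>e 0\<close> itself is sent to
  \<open>- dx \<iota> 0\<close>.\<close>

definition flat :: "(nat \<Rightarrow> real ^ 'd) \<Rightarrow> real ^ 'd \<Rightarrow> real ^ 'd" where
  "flat e y = (\<Sum>j=0..n. g (e j) y *\<^sub>R dx \<iota> j)"

lemma linear_flat: "linear (flat e)"
  by (intro linearI)
    (simp_all add: flat_def g_simps scaleR_left_distrib sum.distrib scaleR_sum_right)

lemmas flat_simps = linear_add[OF linear_flat] linear_diff[OF linear_flat]
  linear_neg[OF linear_flat] linear_scale[OF linear_flat] linear_0[OF linear_flat]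

lemma flat_frame:
  assumes "frame {0..n} e" "k \<le> n"
  shows "flat e (e k) = (if k = 0 then - 1 else 1) *\<^sub>R dx \<iota> k"
proof -
  have "flat e (e k) = (\<Sum>j=0..n. if j = k then (if k = 0 then - 1 else 1) *\<^sub>R dx \<iota> k else 0)"
    unfolding flat_def using assms(2) by (intro sum.cong) (auto simp: frameD[OF assms(1)])
  then show ?thesis using assms(2) by simp
qed

text \<open>The point with new coordinates \<open>x\<close> is \<open>M *v x + d\<close>. The shift
  \<open>d\<close> influences only the constant term, by \<open>K d\<close>.\<close>

lemma change_of_frame:
  assumes fr: "frame {0..n} e"
  shows "\<exists>\<Lambda>\<in>lorentz_group (\<iota> 0). \<exists>c. \<xi> = from_new_coords \<Lambda> c
    (\<lambda>x. (\<Sum>k=0..n. x $ \<iota> k *\<^sub>R flat e (K (e k))) + flat e (K d + \<phi>))"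
proof -
  define M where "M = frame_matrix e"
  obtain \<Lambda> where \<Lambda>: "\<Lambda> \<in> lorentz_group (\<iota> 0)" "M ** \<Lambda> = mat 1"
    using lorentz_inverse[OF frame_matrix_lorentz[OF fr]] unfolding M_def by blast
  have flat: "transpose M *v time_flip y = flat e y" for y
  proof -
    have "flat e y $ \<iota> k = g (e k) y" if "k \<le> n" for k
    proof -
      have "flat e y $ \<iota> k = (\<Sum>j=0..n. if j = k then g (e k) y else 0)"
        unfolding flat_def sum_component using that
        by (intro sum.cong) (auto simp: dx_def axis_def index_eq_iff)
      then show ?thesis using that by simp
    qed
    then show ?thesis
      by (simp add: vec_eq_index M_def transpose_frame_matrix_mult inner_time_flip
          del: transpose_matrix_vector)
  qed
  have \<omega>: "transpose M *v \<xi> (M *v x + d) =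
    (\<Sum>k=0..n. x $ \<iota> k *\<^sub>R flat e (K (e k))) + flat e (K d + \<phi>)" for x
  proof -
    have "transpose M *v \<xi> (M *v x + d) = flat e (K (M *v x) + (K d + \<phi>))"
      by (simp add: \<xi> flat K_simps add.assoc del: transpose_matrix_vector)
    also have "\<dots> = flat e (K (M *v x)) + flat e (K d + \<phi>)" by (rule linear_add[OF linear_flat])
    also have "flat e (K (M *v x)) = (\<Sum>k=0..n. x $ \<iota> k *\<^sub>R flat e (K (e k)))"
      by (simp add: M_def frame_matrix_mult linear_sum[OF linear_K] linear_sum[OF linear_flat]
          K_simps flat_simps)
    finally show ?thesis .
  qed
  have "\<xi> x = transpose \<Lambda> *v (transpose M *v \<xi> (M *v (\<Lambda> *v x + - (\<Lambda> *v d)) + d))" for x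
  proof -
    have "M *v (\<Lambda> *v x + - (\<Lambda> *v d)) + d = (M ** \<Lambda>) *v x - (M ** \<Lambda>) *v d + d"
      by (simp add: matrix_vector_mul_assoc[symmetric] matrix_vector_mult_diff_distrib)
    also have "\<dots> = x" by (simp add: \<Lambda>)
    finally show ?thesis
      by (simp add: matrix_vector_mul_assoc matrix_transpose_mul[symmetric] \<Lambda> transpose_mat
          del: transpose_matrix_vector)
  qed
  then have "\<xi> x = from_new_coords \<Lambda> (- (\<Lambda> *v d))
      (\<lambda>x. (\<Sum>k=0..n. x $ \<iota> k *\<^sub>R flat e (K (e k))) + flat e (K d + \<phi>)) x" for x
    unfolding from_new_coords_def \<omega>[symmetric] .
  then have "\<xi> = from_new_coords \<Lambda> (- (\<Lambda> *v d))
      (\<lambda>x. (\<Sum>k=0..n. x $ \<iota> k *\<^sub>R flat e (K (e k))) + flat e (K d + \<phi>))"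
    by (rule ext)
  then show ?thesis using \<Lambda>(1) by blast
qed

lemma sum_blocks:
  fixes f :: "nat \<Rightarrow> 'b::comm_monoid_add"
  shows "(\<Sum>k=0..m + 2 * r. f k) = (\<Sum>k=0..m. f k) + (\<Sum>i=1..r. f (m + 2 * i - 1) + f (m + 2 * i))"
  by (induction r) (simp_all add: add.assoc)

definition lorentz_form :: "nat \<Rightarrow> real \<Rightarrow> real ^ 'd \<Rightarrow> real ^ 'd" where
  "lorentz_form m a x = (if m = 0 then 0 else if m = 1 then a *\<^sub>R rot \<iota> 0 1 x else null_rot \<iota> x)"

definition brought_into_normal_form :: bool where
  "brought_into_normal_form \<longleftrightarrow> (\<exists>\<Lambda>\<in>lorentz_group (\<iota> 0). \<exists>c \<omega>.
    killing_normal_form n \<iota> \<omega> \<and> \<xi> = from_new_coords \<Lambda> c \<omega>)"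

lemma lorentz_block_cong:
  assumes "\<And>j. j \<le> m \<Longrightarrow> e j = e' j"
  shows "lorentz_block m a e \<longleftrightarrow> lorentz_block m a e'"
proof -
  have "e 0 = e' 0" "1 \<le> m \<longrightarrow> e 1 = e' 1" "2 \<le> m \<longrightarrow> e 2 = e' 2" using assms by simp_all
  then show ?thesis unfolding lorentz_block_def by (cases "m = 0"; cases "m = 1"; simp)
qed

lemma rotation_block_cong:
  assumes "\<And>j. m < j \<Longrightarrow> j \<le> m + 2 * r \<Longrightarrow> e j = e' j"
  shows "rotation_block m r b e \<longleftrightarrow> rotation_block m r b e'"
proof -
  have "e (m + 2 * i - 1) = e' (m + 2 * i - 1)" "e (m + 2 * i) = e' (m + 2 * i)" if "i \<in> {1..r}" for i
    using that by (auto intro!: assms)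
  then show ?thesis unfolding rotation_block_def by simp
qed

text \<open>This collects what each type of block has to supply. Any completion of the frame will
  do, because frame vectors beyond the blocks lie in the kernel. \<open>c0\<close> changes sign when
  the index of \<open>e 0\<close> is lowered.\<close>

lemma normal_form_of_partial_frame:
  assumes fr: "frame J e" and J: "{0..m + 2 * r} \<subseteq> J" "J \<subseteq> {0..n}"
    and lor: "lorentz_block m a e" and rot: "rotation_block m r b e"
    and ker: "\<And>z. z \<in> perp {0..m + 2 * r} e \<Longrightarrow> K z = 0"
    and \<psi>: "K d + \<phi> = c0 *\<^sub>R e 0 + cn *\<^sub>R e n" and cn: "cn \<noteq> 0 \<Longrightarrow> n \<in> J"
    and nf: "killing_normal_form n \<iota> (\<lambda>x. lorentz_form m a x
      + (\<Sum>i=1..r. b i *\<^sub>R rot \<iota> (m + 2 * i - 1) (m + 2 * i) x)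
      + (- c0) *\<^sub>R dx \<iota> 0 + cn *\<^sub>R dx \<iota> n)"
  shows brought_into_normal_form
proof -
  obtain f where f: "frame {0..n} f" "\<And>j. j \<in> J \<Longrightarrow> f j = e j"
  proof (rule frame_extend[OF fr, of "{0..n}"])
    show "0 \<in> J" using J(1) by auto
  qed (use J card_index in auto)
  have fe: "f j = e j" if "j \<le> m + 2 * r" for j using f(2) J(1) that by auto
  have "{0..m + 2 * r} \<subseteq> {0..n}" using J by blast
  then have N: "m + 2 * r \<le> n" by simp
  have lor_f: "lorentz_block m a f" using lor lorentz_block_cong[of m f e] fe by simp
  have rot_f: "rotation_block m r b f" using rot rotation_block_cong[of m r f e] fe by simp
  have Kf: "K (f k) = 0" if "m + 2 * r < k" "k \<le> n" for k
  proof (rule ker)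
    show "f k \<in> perp {0..m + 2 * r} e"
      using that N fe by (intro frame_in_perp[OF f(1)]) auto
  qed
  note ff = flat_frame[OF f(1)]
  have "flat f (K d + \<phi>) = c0 *\<^sub>R flat f (f 0) + cn *\<^sub>R flat f (e n)"
    by (simp add: \<psi> flat_simps fe)
  \<comment> \<open>If \<open>n\<close> is not in \<open>J\<close>, then \<open>e n\<close> may
    differ from \<open>f n\<close>, but its coefficient is zero.\<close>
  also have "cn *\<^sub>R flat f (e n) = cn *\<^sub>R flat f (f n)" using cn f(2) by (cases "cn = 0") auto
  finally have flat_\<psi>: "flat f (K d + \<phi>) = (- c0) *\<^sub>R dx \<iota> 0 + cn *\<^sub>R dx \<iota> n"
    using n by (simp add: ff)
  have lor_sum: "(\<Sum>k=0..m. x $ \<iota> k *\<^sub>R flat f (K (f k))) = lorentz_form m a x" for x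
  proof -
    have s1: "(\<Sum>k=0..1. h k) = h 0 + h 1" and s2: "(\<Sum>k=0..2. h k) = h 0 + h 1 + h 2"
      for h :: "nat \<Rightarrow> real ^ 'd"
      by (simp_all add: numeral_2_eq_2)
    from lor_f consider "m = 0" "K (f 0) = 0"
      | "m = 1" "K (f 0) = a *\<^sub>R f 1" "K (f 1) = a *\<^sub>R f 0"
      | "m = 2" "K (f 0) = f 1" "K (f 1) = f 0 + f 2" "K (f 2) = - f 1"
      unfolding lorentz_block_def by blast
    then show ?thesis
    proof cases
      case 1
      then show ?thesis by (simp add: flat_simps lorentz_form_def)
    next
      case 2
      then show ?thesis using n ff[of 0] ff[of 1]
        by (simp add: s1 flat_simps lorentz_form_def rot_def scaleR_diff_right mult.commute
            del: One_nat_def)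
    next
      case 3
      then have "flat f (f 0) = - dx \<iota> 0" "flat f (f 1) = dx \<iota> 1" "flat f (f 2) = dx \<iota> 2"
        using N by (simp_all add: ff)
      with 3 show ?thesis
        by (simp add: s2 flat_simps lorentz_form_def null_rot_def scaleR_diff_left scaleR_diff_right
            del: One_nat_def)
    qed
  qed
  have rot_sum: "x $ \<iota> (m + 2 * i - 1) *\<^sub>R flat f (K (f (m + 2 * i - 1)))
      + x $ \<iota> (m + 2 * i) *\<^sub>R flat f (K (f (m + 2 * i)))
      = b i *\<^sub>R rot \<iota> (m + 2 * i - 1) (m + 2 * i) x" if i: "i \<in> {1..r}" for x i
  proof -
    have "K (f (m + 2 * i - 1)) = b i *\<^sub>R f (m + 2 * i)"
      "K (f (m + 2 * i)) = (- b i) *\<^sub>R f (m + 2 * i - 1)"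
      using rot_f i by (auto simp: rotation_block_def)
    moreover have "m + 2 * i \<le> n" "m + 2 * i - 1 \<le> n" "m + 2 * i \<noteq> 0" "m + 2 * i - 1 \<noteq> 0"
      using i N by auto
    ultimately show ?thesis
      by (simp add: flat_simps ff rot_def scaleR_diff_right del: One_nat_def) (simp add: mult.commute)
  qed
  have "(\<Sum>k=0..n. x $ \<iota> k *\<^sub>R flat f (K (f k)))
      = (\<Sum>k=0..m + 2 * r. x $ \<iota> k *\<^sub>R flat f (K (f k)))" for x
    using N Kf by (intro sum.mono_neutral_right) (auto simp: flat_simps)
  also have "\<dots> x = lorentz_form m a x
      + (\<Sum>i=1..r. b i *\<^sub>R rot \<iota> (m + 2 * i - 1) (m + 2 * i) x)" for x
    unfolding sum_blocks lor_sum using rot_sum by (metis (no_types, lifting) sum.cong)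
  finally have eq: "(\<lambda>x. (\<Sum>k=0..n. x $ \<iota> k *\<^sub>R flat f (K (f k))) + flat f (K d + \<phi>)) =
      (\<lambda>x. lorentz_form m a x + (\<Sum>i=1..r. b i *\<^sub>R rot \<iota> (m + 2 * i - 1) (m + 2 * i) x)
      + (- c0) *\<^sub>R dx \<iota> 0 + cn *\<^sub>R dx \<iota> n)"
    by (simp only: flat_\<psi> add.assoc)
  from change_of_frame[OF f(1), of d] nf show ?thesis
    unfolding brought_into_normal_form_def eq by blast
qed

lemma frame_le:
  assumes "frame {0..N} e" shows "N \<le> n"
  using frame_card_le[OF assms] card_index by simp

text \<open>The kernel of a skew operator is the complement of its range, here spanned by the images
  of the Lorentz block and the rotation planes. This restores the kernel condition after vectors of
  the Lorentz block are exchanged.\<close>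

lemma in_kernel_if_perp_range:
  assumes fr: "frame {0..m + 2 * r} e" and rot: "rotation_block m r b e"
    and ker: "\<And>z. z \<in> perp {0..m + 2 * r} e \<Longrightarrow> K z = 0"
    and lor_perp: "\<And>j. j \<le> m \<Longrightarrow> g (K (e j)) z = 0"
    and rot_perp: "\<And>j. m < j \<Longrightarrow> j \<le> m + 2 * r \<Longrightarrow> g (e j) z = 0"
  shows "K z = 0"
proof -
  have N: "m + 2 * r \<le> n" using frame_le[OF fr] .
  obtain f where f: "frame {0..n} f" "\<And>j. j \<in> {0..m + 2 * r} \<Longrightarrow> f j = e j"
    using frame_extend[OF fr, of "{0..n}"] N card_index by auto
  have "g (K (f j)) z = 0" if "j \<le> n" for j
  proof (cases "j \<le> m + 2 * r")
    case True
    then have fj: "f j = e j" using f(2) by simp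
    from True show ?thesis
    proof (cases rule: block_index_cases)
      case 1
      then show ?thesis using lor_perp fj by simp
    next
      case (2 i)
      then have "K (e j) = b i *\<^sub>R e (m + 2 * i)" using rot by (simp add: rotation_block_def)
      then show ?thesis using rot_perp[of "m + 2 * i"] 2(1) fj by (simp add: g_simps)
    next
      case (3 i)
      then have "K (e j) = (- b i) *\<^sub>R e (m + 2 * i - 1)" using rot by (simp add: rotation_block_def)
      moreover have "m < m + 2 * i - 1" "m + 2 * i - 1 \<le> m + 2 * r" using 3(1) by auto
      then have "g (e (m + 2 * i - 1)) z = 0" by (rule rot_perp)
      ultimately show ?thesis using fj by (simp add: g_simps)
    qed
  next
    case False
    have "f j \<in> perp {0..m + 2 * r} e"
      using that False N f(2) by (intro frame_in_perp[OF f(1)]) auto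
    then show ?thesis by (simp add: ker g_simps)
  qed
  then have "g (f j) (K z) = 0" if "j \<le> n" for j using that skew[of "f j" z] by simp
  then show ?thesis by (rule frame_full_perp[OF f(1) card_index])
qed

section \<open>Translations and the list of forms\<close>

lemma rotation_in_range:
  assumes rot: "rotation_block m r b e" and j: "m < j" "j \<le> m + 2 * r"
  shows "e j \<in> range K"
  using j(2)
proof (cases rule: block_index_cases)
  case (2 i)
  then have "0 < b i" "K (e (m + 2 * i)) = (- b i) *\<^sub>R e j" using rot by (auto simp: rotation_block_def)
  then have "e j = K ((- 1 / b i) *\<^sub>R e (m + 2 * i))" by (simp add: K_simps)
  then show ?thesis by blast
next
  case (3 i)
  then have "0 < b i" "K (e (m + 2 * i - 1)) = b i *\<^sub>R e j" using rot by (auto simp: rotation_block_def)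
  then have "e j = K ((1 / b i) *\<^sub>R e (m + 2 * i - 1))" by (simp add: K_simps)
  then show ?thesis by blast
qed (use j(1) in simp)

text \<open>\<open>w\<close> is the projection of \<phi> to the span of the chosen vectors, with
  \<open>g (e j) (e j)\<close> as the sign of a timelike one. A preimage of \<open>- w\<close> is
  the required shift.\<close>

lemma exists_translation:
  assumes fr: "frame I e" and A: "A \<subseteq> I" "finite A" and range: "\<And>j. j \<in> A \<Longrightarrow> e j \<in> range K"
  obtains d where "\<And>j. j \<in> A \<Longrightarrow> g (e j) (K d + \<phi>) = 0"
proof -
  define w where "w = (\<Sum>j\<in>A. (g (e j) (e j) * g (e j) \<phi>) *\<^sub>R e j)"
  have sub: "subspace (range K)" using linear_K by (simp add: linear_subspace_image)
  have "w \<in> range K"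
    unfolding w_def using range by (intro subspace_sum[OF sub] subspace_scale[OF sub]) auto
  then obtain d where d: "w = K d" by blast
  have "g (e k) (K (- d) + \<phi>) = 0" if k: "k \<in> A" for k
  proof -
    have sq: "g (e k) (e k) * g (e k) (e k) = 1"
      using frameD[OF fr, of k k] k A(1) by auto
    have "g (e k) w = (\<Sum>j\<in>A. if j = k then g (e k) \<phi> else 0)"
      unfolding w_def g_sum
    proof (rule sum.cong)
      fix j assume "j \<in> A"
      then have "g (e k) (e j) = (if k = j then g (e k) (e k) else 0)"
        using frameD[OF fr, of k j] subsetD[OF A(1)] k by auto
      then show "g (e k) ((g (e j) (e j) * g (e j) \<phi>) *\<^sub>R e j) = (if j = k then g (e k) \<phi> else 0)"
        using sq by (auto simp: g_simps)
    qed simp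
    then have "g (e k) w = g (e k) \<phi>" using k A(2) by simp
    then show ?thesis by (simp add: K_simps g_simps flip: d)
  qed
  then show thesis by (rule that)
qed

lemma rot_coeffs_if_block:
  "rotation_block m r b e \<Longrightarrow> antimono_on {1..r} b \<Longrightarrow> 1 \<le> r \<Longrightarrow> rot_coeffs r b"
  by (simp add: rot_coeffs_def rotation_block_def)

text \<open>Forms (a), (b), (c) without rotation planes, (e), (h), (i) with them.
  \<open>0 + 2 * r\<close> is kept unreduced to match \<open>m + 2 * r\<close> in
  \<open>normal_form_of_partial_frame\<close>.\<close>

lemma normal_form_stationary:
  assumes rc: "1 \<le> r \<Longrightarrow> rot_coeffs r b" and r: "0 + 2 * r \<le> n"
    and c: "0 \<le> c0 \<and> cn = 0 \<and> (1 \<le> r \<or> 0 < c0) \<or>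
      (c0 = 0 \<and> 0 < cn \<or> c0 = 1 \<and> cn = 1) \<and> 0 + 2 * r < n"
  shows "killing_normal_form n \<iota> (\<lambda>x. lorentz_form 0 a x
      + (\<Sum>i=1..r. b i *\<^sub>R rot \<iota> (0 + 2 * i - 1) (0 + 2 * i) x)
      + (- c0) *\<^sub>R dx \<iota> 0 + cn *\<^sub>R dx \<iota> n)"
proof (cases "r = 0")
  case True
  with c n show ?thesis
    using killing_normal_form.form_a[of n "- c0" \<iota>] killing_normal_form.form_b[of n cn \<iota>]
      killing_normal_form.form_c[of n \<iota>]
    by (auto simp: lorentz_form_def)
next
  case False
  with c r show ?thesis
    using killing_normal_form.form_e[of n r b "- c0" \<iota>] killing_normal_form.form_h[of n r b cn \<iota>]
      killing_normal_form.form_i[of n r b \<iota>] rc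
    by (auto simp: lorentz_form_def)
qed

lemma normal_form_boost:
  assumes rc: "1 \<le> r \<Longrightarrow> rot_coeffs r b" and r: "1 + 2 * r \<le> n" and a: "0 < a"
    and c: "cn = 0 \<or> 0 < cn \<and> 1 + 2 * r < n"
  shows "killing_normal_form n \<iota> (\<lambda>x. lorentz_form 1 a x
      + (\<Sum>i=1..r. b i *\<^sub>R rot \<iota> (1 + 2 * i - 1) (1 + 2 * i) x)
      + (- 0) *\<^sub>R dx \<iota> 0 + cn *\<^sub>R dx \<iota> n)"
proof (cases "r = 0")
  case True
  with c n a show ?thesis
    using killing_normal_form.form_d[of n a \<iota>] killing_normal_form.form_f[of n a cn \<iota>]
    by (auto simp: lorentz_form_def)
next
  case False
  with c r a show ?thesis
    using killing_normal_form.form_j[of n r a b \<iota>] killing_normal_form.form_l[of n r a b cn \<iota>] rc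
    by (auto simp: lorentz_form_def)
qed

lemma normal_form_null:
  assumes rc: "1 \<le> r \<Longrightarrow> rot_coeffs r b" and r: "2 + 2 * r \<le> n"
    and c: "0 \<le> c0 \<and> cn = 0 \<or> c0 = 0 \<and> 0 < cn \<and> 2 + 2 * r < n"
  shows "killing_normal_form n \<iota> (\<lambda>x. lorentz_form 2 a x
      + (\<Sum>i=1..r. b i *\<^sub>R rot \<iota> (2 + 2 * i - 1) (2 + 2 * i) x)
      + (- c0) *\<^sub>R dx \<iota> 0 + cn *\<^sub>R dx \<iota> n)"
proof (cases "r = 0")
  case True
  with c r show ?thesis
    using killing_normal_form.form_g[of n "- c0" \<iota>] killing_normal_form.form_k[of n cn \<iota>]
    by (auto simp: lorentz_form_def)
next
  case False
  with c r show ?thesis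
    using killing_normal_form.form_m[of n r b "- c0" \<iota>] killing_normal_form.form_n[of n r b cn \<iota>] rc
    by (auto simp: lorentz_form_def)
qed

section \<open>Normalising the constant term for each type of block\<close>

text \<open>As \<open>0 < a\<close>, all block vectors lie in the range of \<open>K\<close>, and a
  translation clears their components. The remainder is orthogonal to a timelike vector, hence zero
  or spacelike, and its direction becomes \<open>e n\<close>.\<close>

lemma boost_case:
  assumes fr: "frame {0..1 + 2 * r} e" and lor: "lorentz_block 1 a e"
    and rot: "rotation_block 1 r b e" and mono: "antimono_on {1..r} b"
    and ker: "\<And>z. z \<in> perp {0..1 + 2 * r} e \<Longrightarrow> K z = 0"
  shows brought_into_normal_form
proof -
  have a: "0 < a" "K (e 0) = a *\<^sub>R e 1" "K (e 1) = a *\<^sub>R e 0" using lor by (auto simp: lorentz_block_def)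
  have range: "e j \<in> range K" if "j \<in> {0..1 + 2 * r}" for j
  proof -
    consider "j = 0" | "j = 1" | "1 < j" by linarith
    then show ?thesis
    proof cases
      case 1
      then have "e j = K ((1 / a) *\<^sub>R e 1)" using a by (simp add: K_simps)
      then show ?thesis by blast
    next
      case 2
      then have "e j = K ((1 / a) *\<^sub>R e 0)" using a by (simp add: K_simps)
      then show ?thesis by blast
    qed (use rotation_in_range[OF rot] that in simp)
  qed
  obtain d where d: "\<And>j. j \<in> {0..1 + 2 * r} \<Longrightarrow> g (e j) (K d + \<phi>) = 0"
    using exists_translation[OF fr order_refl _ range] by auto
  define \<psi> where "\<psi> = K d + \<phi>"
  note nf = normal_form_boost[OF rot_coeffs_if_block[OF rot mono] _ a(1)]
  show ?thesis
  proof (cases "\<psi> = 0")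
    case True
    show ?thesis
    proof (rule normal_form_of_partial_frame[OF fr order_refl _ lor rot ker])
      show "K d + \<phi> = 0 *\<^sub>R e 0 + 0 *\<^sub>R e n" using True by (simp add: \<psi>_def)
      show "killing_normal_form n \<iota> (\<lambda>x. lorentz_form 1 a x
        + (\<Sum>i=1..r. b i *\<^sub>R rot \<iota> (1 + 2 * i - 1) (1 + 2 * i) x)
        + (- 0) *\<^sub>R dx \<iota> 0 + 0 *\<^sub>R dx \<iota> n)"
        using frame_le[OF fr] by (intro nf) auto
    qed (use frame_le[OF fr] in auto)
  next
    case False
    have pos: "0 < g \<psi> \<psi>" using frame_perp_pos[OF fr _ d[folded \<psi>_def] False] by simp
    define q where "q = sqrt (g \<psi> \<psi>)"
    have q: "0 < q" "q * q = g \<psi> \<psi>" using pos by (auto simp: q_def)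
    define x where "x = (1 / q) *\<^sub>R \<psi>"
    have x: "g x x = 1" "\<And>j. j \<in> {0..1 + 2 * r} \<Longrightarrow> g (e j) x = 0"
      using q d[folded \<psi>_def] by (auto simp: x_def g_simps field_simps)
    \<comment> \<open>A trial frame with \<open>x\<close> at the next free index shows that there is
      room; only then is \<open>x\<close> placed at \<open>n\<close>.\<close>
    have "frame (insert (2 + 2 * r) {0..1 + 2 * r}) (e(2 + 2 * r := x))"
      using x by (intro frame_insert[OF fr]) auto
    also have "insert (2 + 2 * r) {0..1 + 2 * r} = {0..2 + 2 * r}" by auto
    finally have N: "2 + 2 * r \<le> n" by (rule frame_le)
    define e' where "e' = e(n := x)"
    have e': "e' j = e j" if "j \<le> 1 + 2 * r" for j using that N by (simp add: e'_def)
    have fr': "frame (insert n {0..1 + 2 * r}) e'"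
      unfolding e'_def using x N by (intro frame_insert[OF fr]) auto
    show ?thesis
    proof (rule normal_form_of_partial_frame[OF fr'])
      show "lorentz_block 1 a e'" using lor lorentz_block_cong[of 1 e' e a] e' by simp
      show "rotation_block 1 r b e'" using rot rotation_block_cong[of 1 r e' e b] e' by simp
      show "K z = 0" if "z \<in> perp {0..1 + 2 * r} e'" for z
        using that e' by (intro ker) (simp add: perp_def)
      show "K d + \<phi> = 0 *\<^sub>R e' 0 + q *\<^sub>R e' n" using q(1) by (simp add: e'_def x_def \<psi>_def)
      show "killing_normal_form n \<iota> (\<lambda>x. lorentz_form 1 a x
        + (\<Sum>i=1..r. b i *\<^sub>R rot \<iota> (1 + 2 * i - 1) (1 + 2 * i) x)
        + (- 0) *\<^sub>R dx \<iota> 0 + q *\<^sub>R dx \<iota> n)"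
        using N q(1) by (intro nf) auto
    qed (use N in auto)
  qed
qed

text \<open>Since \<open>K\<close> kills \<open>e 0\<close>, any unit timelike kernel vector
  orthogonal to the rotation planes can replace it. The new time axis is adapted to the causal type
  of the remainder \<psi>.\<close>

lemma stationary_case:
  assumes fr: "frame {0..0 + 2 * r} e" and lor: "lorentz_block 0 a e"
    and rot: "rotation_block 0 r b e" and mono: "antimono_on {1..r} b"
    and ker: "\<And>z. z \<in> perp {0..0 + 2 * r} e \<Longrightarrow> K z = 0"
  shows brought_into_normal_form
proof -
  define N where "N = 0 + 2 * r"
  have K0: "K (e 0) = 0" using lor by (simp add: lorentz_block_def)
  have N_eq: "insert 0 {1..N} = {0..N}" by auto
  have g00: "g (e 0) (e 0) = - 1" using frameD[OF fr, of 0 0] by simp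
  have g0j: "g (e j) (e 0) = 0" if "j \<in> {1..N}" for j using frameD[OF fr, of j 0] that by (auto simp: N_def)
  obtain d where d: "\<And>j. j \<in> {1..N} \<Longrightarrow> g (e j) (K d + \<phi>) = 0"
  proof (rule exists_translation[OF fr, of "{1..N}"])
    show "e j \<in> range K" if "j \<in> {1..N}" for j
      using that by (intro rotation_in_range[OF rot]) (auto simp: N_def)
  qed (auto simp: N_def)
  define \<psi> where "\<psi> = K d + \<phi>"
  define \<alpha> where "\<alpha> = - g (e 0) \<psi>"
  define s where "s = \<psi> - \<alpha> *\<^sub>R e 0"
  have \<psi>: "\<psi> = \<alpha> *\<^sub>R e 0 + s" by (simp add: s_def)
  have s0: "g (e 0) s = 0" "g s (e 0) = 0"
    using g00 by (simp_all add: s_def g_simps \<alpha>_def g_commute[of \<psi> "e 0"])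
  have sj: "g (e j) s = 0" if "j \<in> {1..N}" for j
    using d[OF that] g0j[OF that] by (simp add: s_def g_simps \<psi>_def)
  have \<psi>\<psi>: "g \<psi> \<psi> = g s s - \<alpha>\<^sup>2"
    by (simp add: \<psi> g_simps s0 g00 power2_eq_square)
  have frR: "frame {1..N} e" using frame_subset[OF fr] by (simp add: N_def)
  have replace0: "frame {0..N} (e(0 := x))"
    if "g x x = - 1" "\<And>j. j \<in> {1..N} \<Longrightarrow> g (e j) x = 0" for x
    using frame_insert[OF frR, of 0 x] that unfolding N_eq by simp
  have ker': "K z = 0" if z: "z \<in> perp {0..0 + 2 * r} e'" and e': "\<And>j. j \<in> {1..N} \<Longrightarrow> e' j = e j" for z e'
  proof (rule in_kernel_if_perp_range[OF fr rot ker])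
    show "g (K (e j)) z = 0" if "j \<le> 0" for j using that by (simp add: K0 g_simps)
    show "g (e j) z = 0" if "0 < j" "j \<le> 0 + 2 * r" for j
    proof -
      have "j \<in> {1..N}" "j \<in> {0..0 + 2 * r}" using that by (auto simp: N_def)
      then show ?thesis using z e' unfolding perp_def by fastforce
    qed
  qed
  note nf = normal_form_stationary[OF rot_coeffs_if_block[OF rot mono]]
  have one: brought_into_normal_form
    if x: "g x x = - 1" "\<And>j. j \<in> {1..N} \<Longrightarrow> g (e j) x = 0" "K x = 0"
      and c: "\<psi> = c *\<^sub>R x" "0 \<le> c" "1 \<le> r \<or> 0 < c" for x c
  proof (rule normal_form_of_partial_frame)
    show "frame {0..0 + 2 * r} (e(0 := x))" using replace0[OF x(1,2)] by (simp add: N_def)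
    show "{0..0 + 2 * r} \<subseteq> {0..n}" using frame_le[OF fr] by simp
    show "lorentz_block 0 a (e(0 := x))" using x(3) by (simp add: lorentz_block_def)
    show "rotation_block 0 r b (e(0 := x))" using rot rotation_block_cong[of 0 r "e(0 := x)" e b] by simp
    show "K z = 0" if "z \<in> perp {0..0 + 2 * r} (e(0 := x))" for z using that by (rule ker') simp
    show "K d + \<phi> = c *\<^sub>R (e(0 := x)) 0 + 0 *\<^sub>R (e(0 := x)) n" using c by (simp add: \<psi>_def)
    show "killing_normal_form n \<iota> (\<lambda>x. lorentz_form 0 a x
        + (\<Sum>i=1..r. b i *\<^sub>R rot \<iota> (0 + 2 * i - 1) (0 + 2 * i) x)
        + (- c) *\<^sub>R dx \<iota> 0 + 0 *\<^sub>R dx \<iota> n)"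
      using c frame_le[OF fr] by (intro nf) auto
  qed auto
  have two: brought_into_normal_form
    if x: "g x x = - 1" "\<And>j. j \<in> {1..N} \<Longrightarrow> g (e j) x = 0" "K x = 0"
      and y: "g y y = 1" "\<And>j. j \<in> {1..N} \<Longrightarrow> g (e j) y = 0" "g x y = 0"
      and c: "\<psi> = c0 *\<^sub>R x + cn *\<^sub>R y" "c0 = 0 \<and> 0 < cn \<or> c0 = 1 \<and> cn = 1" for x y c0 cn
  proof -
    have y': "g ((e(0 := x)) j) y = 0" if "j \<in> {0..N}" for j using y that by (cases "j = 0") auto
    have ins: "frame (insert k {0..N}) (e(0 := x, k := y))" if "N < k" for k
      using y' y(1) that by (intro frame_insert replace0[OF x(1,2)]) auto
    have "insert (N + 1) {0..N} = {0..N + 1}" by auto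
    then have "frame {0..N + 1} (e(0 := x, N + 1 := y))" using ins[of "N + 1"] by simp
    from frame_le[OF this] have N: "N < n" by simp
    define e' where "e' = e(0 := x, n := y)"
    have e': "e' 0 = x" "e' n = y" "\<And>j. j \<in> {1..N} \<Longrightarrow> e' j = e j" using N by (auto simp: e'_def)
    show ?thesis
    proof (rule normal_form_of_partial_frame)
      show "frame (insert n {0..N}) e'" unfolding e'_def using ins[OF N] .
      show "lorentz_block 0 a e'" using x(3) e' by (simp add: lorentz_block_def)
      show "rotation_block 0 r b e'"
        using rot rotation_block_cong[of 0 r e' e b] e'(3) by (simp add: N_def)
      show "K z = 0" if "z \<in> perp {0..0 + 2 * r} e'" for z using that by (rule ker') (rule e'(3))
      show "K d + \<phi> = c0 *\<^sub>R e' 0 + cn *\<^sub>R e' n" using c e' by (simp add: \<psi>_def)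
      show "killing_normal_form n \<iota> (\<lambda>x. lorentz_form 0 a x
        + (\<Sum>i=1..r. b i *\<^sub>R rot \<iota> (0 + 2 * i - 1) (0 + 2 * i) x)
        + (- c0) *\<^sub>R dx \<iota> 0 + cn *\<^sub>R dx \<iota> n)"
        using c N by (intro nf) (auto simp: N_def)
    qed (use N in \<open>auto simp: N_def\<close>)
  qed
  have Ks: "K s = 0"
    using sj s0 by (intro ker) (auto simp: perp_def N_def Suc_le_eq, metis gr0I)
  consider "\<psi> = 0" | "\<psi> \<noteq> 0" "g \<psi> \<psi> = 0" | "g \<psi> \<psi> < 0" | "0 < g \<psi> \<psi>" by force
  then show ?thesis
  proof cases
    case 1
    \<comment> \<open>Without a rotation plane \<open>K\<close> vanishes identically and \<phi>
      equals \<psi>, so the field would be zero.\<close>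
    have "1 \<le> r"
    proof (rule ccontr)
      assume "\<not> 1 \<le> r"
      have Kz: "K z = 0" for z
      proof (rule in_kernel_if_perp_range[OF fr rot ker])
        show "g (K (e j)) z = 0" if "j \<le> 0" for j using that by (simp add: K0 g_simps)
      qed (use \<open>\<not> 1 \<le> r\<close> in auto)
      then have "\<phi> = 0" using 1 by (simp add: \<psi>_def)
      then have "\<xi> = (\<lambda>x. 0)" using Kz by (simp add: fun_eq_iff \<xi> time_flip_def)
      then show False using nonzero by simp
    qed
    then show ?thesis using g00 g0j K0 1 by (intro one[of "e 0" 0]) auto
  next
    case 2
    have "\<alpha> \<noteq> 0"
    proof
      assume "\<alpha> = 0"
      then have "g s s = 0" "s \<noteq> 0" using 2 \<psi>\<psi> \<psi> by auto
      then show False using timelike_perp[of "e 0" s] g00 s0 by simp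
    qed
    define p where "p = (1 / \<alpha>) *\<^sub>R s"
    have p: "g p p = 1" "g (e 0) p = 0" "g p (e 0) = 0" "K p = 0" "\<And>j. j \<in> {1..N} \<Longrightarrow> g (e j) p = 0"
      using \<open>\<alpha> \<noteq> 0\<close> 2 \<psi>\<psi> s0 sj Ks by (auto simp: p_def g_simps K_simps power2_eq_square)
    \<comment> \<open>Hyperbolic cosine and sine of a boost in the plane of \<open>e 0\<close> and
      \<open>p\<close> whose rapidity has exponential \<alpha>; for negative \<alpha> both axes are
      also reversed. The boost scales the null vector \<open>e 0 + p\<close> by \<alpha>, which
      makes both coefficients of \<psi> equal to 1.\<close>
    define ch sh where "ch = (\<alpha> + 1 / \<alpha>) / 2" and "sh = (\<alpha> - 1 / \<alpha>) / 2"
    have sum: "ch + sh = \<alpha>" and diff: "ch - sh = 1 / \<alpha>"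
      by (simp_all add: ch_def sh_def field_simps)
    have "ch * ch - sh * sh = (ch + sh) * (ch - sh)" by (simp add: algebra_simps)
    then have hyp: "ch * ch - sh * sh = 1" using \<open>\<alpha> \<noteq> 0\<close> by (simp add: sum diff)
    have "\<psi> = (ch + sh) *\<^sub>R (e 0 + p)"
      using \<open>\<alpha> \<noteq> 0\<close> by (simp add: sum p_def \<psi> scaleR_add_right)
    then have \<psi>_eq: "\<psi> = 1 *\<^sub>R (ch *\<^sub>R e 0 + sh *\<^sub>R p) + 1 *\<^sub>R (sh *\<^sub>R e 0 + ch *\<^sub>R p)"
      by (simp add: algebra_simps)
    show ?thesis
      by (rule two[OF _ _ _ _ _ _ \<psi>_eq]) (use hyp p g00 g0j K0 in \<open>auto simp: g_simps K_simps\<close>)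
  next
    case 3
    \<comment> \<open>The time axis is laid along \<psi>, be it future or past directed, so its
      coefficient is positive.\<close>
    define q where "q = sqrt (- g \<psi> \<psi>)"
    have q: "0 < q" "q * q = - g \<psi> \<psi>" using 3 by (auto simp: q_def)
    have "K \<psi> = 0" by (simp add: \<psi> K_simps K0 Ks)
    then show ?thesis using q d[folded \<psi>_def]
      by (intro one[of "(1 / q) *\<^sub>R \<psi>" q]) (auto simp: g_simps K_simps field_simps)
  next
    case 4
    define \<sigma> where "\<sigma> = g s s"
    have \<sigma>: "\<alpha>\<^sup>2 < \<sigma>" "0 < \<sigma>" using 4 \<psi>\<psi> by (auto simp: \<sigma>_def intro: le_less_trans[of 0 "\<alpha>\<^sup>2"])
    \<comment> \<open>The direction orthogonal to \<psi> in the plane of \<open>e 0\<close> and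
      \<open>s\<close>; it is timelike because \<psi> is spacelike.\<close>
    define u where "u = \<sigma> *\<^sub>R e 0 + \<alpha> *\<^sub>R s"
    have "g u u = \<sigma> * (\<alpha>\<^sup>2 - \<sigma>)"
      by (simp add: u_def g_simps s0 g00 \<sigma>_def[symmetric] power2_eq_square algebra_simps)
    then have uu: "g u u < 0" using \<sigma> by (simp add: mult_pos_neg)
    have u\<psi>: "g u \<psi> = 0"
      by (simp add: u_def \<psi> g_simps s0 g00 \<sigma>_def[symmetric])
    have Ku: "K u = 0" by (simp add: u_def K_simps K0 Ks)
    have uj: "g (e j) u = 0" if "j \<in> {1..N}" for j using g0j sj that by (simp add: u_def g_simps)
    define p q where "p = sqrt (- g u u)" and "q = sqrt (g \<psi> \<psi>)"
    have pq: "0 < p" "p * p = - g u u" "0 < q" "q * q = g \<psi> \<psi>" using 4 uu by (auto simp: p_def q_def)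
    show ?thesis using pq u\<psi> Ku uj d[folded \<psi>_def]
      by (intro two[of "(1 / p) *\<^sub>R u" "(1 / q) *\<^sub>R \<psi>" 0 q])
        (auto simp: g_simps K_simps field_simps)
  qed
qed

text \<open>On the block the range of \<open>K\<close> is spanned by \<open>e 1\<close> and
  \<open>v = e 0 + e 2\<close>. The vector \<open>v\<close> is not in the frame, so its share is
  removed separately. A time component \<open>c\<close> and a vector \<open>s\<close> orthogonal to
  all blocks remain.\<close>

lemma null_case:
  assumes fr: "frame {0..2 + 2 * r} e" and lor: "lorentz_block 2 a e"
    and rot: "rotation_block 2 r b e" and mono: "antimono_on {1..r} b"
    and ker: "\<And>z. z \<in> perp {0..2 + 2 * r} e \<Longrightarrow> K z = 0"
  shows brought_into_normal_form
proof -
  define N where "N = 2 + 2 * r"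
  have K: "K (e 0) = e 1" "K (e 1) = e 0 + e 2" "K (e 2) = - e 1" using lor by (auto simp: lorentz_block_def)
  define A where "A = insert 1 {3..N}"
  obtain d where d: "\<And>j. j \<in> A \<Longrightarrow> g (e j) (K d + \<phi>) = 0"
  proof (rule exists_translation[OF fr, of A])
    show "e j \<in> range K" if "j \<in> A" for j
    proof (cases "j = 1")
      case True
      then show ?thesis using K(1) by (metis rangeI)
    next
      case False
      then show ?thesis using that by (intro rotation_in_range[OF rot]) (auto simp: A_def N_def)
    qed
  qed (auto simp: A_def N_def)
  have gb: "g (e 0) (e 0) = - 1" "g (e 1) (e 1) = 1" "g (e 2) (e 2) = 1" "g (e 0) (e 1) = 0" "g (e 1) (e 0) = 0"
    "g (e 0) (e 2) = 0" "g (e 2) (e 0) = 0" "g (e 1) (e 2) = 0" "g (e 2) (e 1) = 0"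
    by (simp_all add: frameD[OF fr])
  have gj: "g (e j) (e 0) = 0" "g (e j) (e 1) = 0" "g (e j) (e 2) = 0" if "j \<in> {3..N}" for j
    using that by (auto simp: N_def frameD[OF fr])
  define v where "v = e 0 + e 2"
  define \<psi> where "\<psi> = K d + \<phi>"
  \<comment> \<open>Because \<open>K (e 1) = v\<close>, shifting by
    \<open>- \<gamma> *\<^sub>R e 1\<close> subtracts \<open>\<gamma> *\<^sub>R v\<close>, which
    clears the component along \<open>e 2\<close>.\<close>
  define \<gamma> where "\<gamma> = g (e 2) \<psi>"
  define c where "c = - g (e 0) \<psi> - \<gamma>"
  define s where "s = \<psi> - \<gamma> *\<^sub>R v - c *\<^sub>R e 0"
  have \<psi>: "K (d - \<gamma> *\<^sub>R e 1) + \<phi> = c *\<^sub>R e 0 + s"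
    by (simp add: K_simps K s_def v_def \<psi>_def del: One_nat_def)
  have s012: "g (e 0) s = 0" "g (e 1) s = 0" "g (e 2) s = 0"
    using d[of 1] unfolding \<psi>_def[symmetric]
    by (simp_all add: s_def v_def c_def \<gamma>_def g_simps gb A_def del: One_nat_def)
  have sj: "g (e j) s = 0" if "j \<in> {3..N}" for j
    using d[of j] gj[OF that] that by (simp add: s_def v_def g_simps A_def \<psi>_def)
  have N_cases: "j = 0 \<or> j = 1 \<or> j = 2 \<or> j \<in> {3..N}" if "j \<in> {0..N}" for j using that by auto
  have s_perp: "g (e j) s = 0" if "j \<in> {0..N}" for j using N_cases[OF that] s012 sj by auto
  then have Ks: "K s = 0" by (intro ker) (simp add: perp_def N_def)
  note nf = normal_form_null[OF rot_coeffs_if_block[OF rot mono]]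
  consider "c = 0" "s = 0" | "c = 0" "s \<noteq> 0" | "c \<noteq> 0" by blast
  then show ?thesis
  proof cases
    case 1
    show ?thesis
    proof (rule normal_form_of_partial_frame[OF fr order_refl _ lor rot ker])
      show "K (d - \<gamma> *\<^sub>R e 1) + \<phi> = 0 *\<^sub>R e 0 + 0 *\<^sub>R e n" using 1 \<psi> by simp
      show "killing_normal_form n \<iota> (\<lambda>x. lorentz_form 2 a x
        + (\<Sum>i=1..r. b i *\<^sub>R rot \<iota> (2 + 2 * i - 1) (2 + 2 * i) x)
        + (- 0) *\<^sub>R dx \<iota> 0 + 0 *\<^sub>R dx \<iota> n)"
        using frame_le[OF fr] by (intro nf) auto
    qed (use frame_le[OF fr] in auto)
  next
    case 2
    have pos: "0 < g s s" using frame_perp_pos[OF fr _ _ 2(2)] s_perp by (simp add: N_def)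
    define q where "q = sqrt (g s s)"
    have q: "0 < q" "q * q = g s s" using pos by (auto simp: q_def)
    define x where "x = (1 / q) *\<^sub>R s"
    have x: "g x x = 1" "\<And>j. j \<in> {0..N} \<Longrightarrow> g (e j) x = 0"
      using q s_perp by (auto simp: x_def g_simps field_simps)
    have ins: "frame (insert k {0..N}) (e(k := x))" if "N < k" for k
      using x that fr by (intro frame_insert) (auto simp: N_def)
    have "insert (N + 1) {0..N} = {0..N + 1}" by auto
    then have "frame {0..N + 1} (e(N + 1 := x))" using ins[of "N + 1"] by simp
    from frame_le[OF this] have N: "N < n" by simp
    define e' where "e' = e(n := x)"
    have e': "e' j = e j" if "j \<le> N" for j using that N by (simp add: e'_def)
    show ?thesis
    proof (rule normal_form_of_partial_frame)
      show "frame (insert n {0..N}) e'" unfolding e'_def using ins[OF N] .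
      show "lorentz_block 2 a e'" using lor lorentz_block_cong[of 2 e' e a] e' by (simp add: N_def)
      show "rotation_block 2 r b e'" using rot rotation_block_cong[of 2 r e' e b] e' by (simp add: N_def)
      show "K z = 0" if "z \<in> perp {0..2 + 2 * r} e'" for z
        using that e' by (intro ker) (simp add: perp_def N_def)
      show "K (d - \<gamma> *\<^sub>R e 1) + \<phi> = 0 *\<^sub>R e' 0 + q *\<^sub>R e' n"
        using q(1) 2 \<psi> by (simp add: e'_def x_def)
      show "killing_normal_form n \<iota> (\<lambda>x. lorentz_form 2 a x
        + (\<Sum>i=1..r. b i *\<^sub>R rot \<iota> (2 + 2 * i - 1) (2 + 2 * i) x)
        + (- 0) *\<^sub>R dx \<iota> 0 + q *\<^sub>R dx \<iota> n)"
        using N q(1) by (intro nf) (auto simp: N_def)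
    qed (use N in \<open>auto simp: N_def\<close>)
  next
    case 3
    text \<open>
      The null rotation about \<open>v\<close> that maps \<open>e 0\<close> to \<open>e 0 + s / c\<close> modulo \<open>v\<close> commutes with \<open>K\<close> and
      removes \<open>s\<close>; the multiple of \<open>v = K (e 1)\<close> that is left over is absorbed by a translation.
    \<close>
    define y where "y = (1 / c) *\<^sub>R s"
    \<comment> \<open>Adding \<open>k *\<^sub>R v\<close> lowers the square by \<open>2 * k\<close>,
      which compensates the contribution of \<open>y\<close>.\<close>
    define k where "k = g y y / 2"
    define x where "x = e 0 + y + k *\<^sub>R v"
    \<comment> \<open>Multiplying all three block vectors by this sign commutes with
      \<open>K\<close> and turns the time coefficient into \<open>\<bar>c\<bar>\<close>.\<close>
    define \<sigma> where "\<sigma> = sgn c"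
    have \<sigma>: "\<sigma> * \<sigma> = 1" "\<sigma> * c = \<bar>c\<bar>" "\<bar>c\<bar> * \<sigma> = c" using 3 by (auto simp: \<sigma>_def sgn_if)
    have y012: "g (e 0) y = 0" "g (e 1) y = 0" "g (e 2) y = 0" "g y (e 0) = 0" "g y (e 1) = 0" "g y (e 2) = 0"
      using s012 by (simp_all add: y_def g_simps g_commute[of s])
    have Kx: "K x = e 1" by (simp add: x_def y_def v_def K_simps Ks K)
    have Kv: "K v = 0" by (simp add: v_def K_simps K)
    have xx: "g x x = - 1" by (simp add: x_def v_def g_simps y012 gb k_def)
    have xv: "g x v = - 1" "g v x = - 1" by (simp_all add: x_def v_def g_simps y012 gb)
    have vv: "g v v = 0" by (simp add: v_def g_simps gb)
    have e1x: "g (e 1) x = 0" "g x (e 1) = 0" "g (e 1) v = 0" "g v (e 1) = 0"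
      by (simp_all add: x_def v_def g_simps y012 gb del: One_nat_def)
    have jx: "g (e j) x = 0" "g (e j) v = 0" if "j \<in> {3..N}" for j
      using gj[OF that] sj[OF that] by (simp_all add: x_def y_def v_def g_simps)
    define e0 where "e0 = e(0 := \<sigma> *\<^sub>R x)"
    define e1 where "e1 = e0(1 := \<sigma> *\<^sub>R e 1)"
    define e' where "e' = e1(2 := \<sigma> *\<^sub>R (v - x))"
    have e': "e' 0 = \<sigma> *\<^sub>R x" "e' 1 = \<sigma> *\<^sub>R e 1" "e' 2 = \<sigma> *\<^sub>R (v - x)" "\<And>j. j \<in> {3..N} \<Longrightarrow> e' j = e j"
      by (auto simp: e'_def e1_def e0_def)
    have \<sigma>\<sigma>: "\<sigma> * (\<sigma> * z) = z" for z using \<sigma>(1) by (simp add: mult.assoc[symmetric])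
    have "frame {3..N} e" using frame_subset[OF fr] by (simp add: N_def)
    then have "frame (insert 0 {3..N}) e0"
      unfolding e0_def using jx xx \<sigma>\<sigma> by (intro frame_insert) (auto simp: g_simps)
    then have "frame (insert 1 (insert 0 {3..N})) e1"
      unfolding e1_def using gj e1x \<sigma>\<sigma> gb
      by (intro frame_insert) (auto simp: g_simps e0_def)
    then have "frame (insert 2 (insert 1 (insert 0 {3..N}))) e'"
      unfolding e'_def using jx xx xv vv e1x \<sigma>\<sigma>
      by (intro frame_insert) (auto simp: g_simps e0_def e1_def)
    also have "insert 2 (insert 1 (insert 0 {3..N})) = {0..2 + 2 * r}" by (auto simp: N_def)
    finally have fr': "frame {0..2 + 2 * r} e'" .
    show ?thesis
    proof (rule normal_form_of_partial_frame[OF fr' order_refl])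
      show "lorentz_block 2 a e'"
        unfolding lorentz_block_def e' by (simp add: K_simps Kx Kv K v_def scaleR_diff_right del: One_nat_def)
      show "rotation_block 2 r b e'"
        using rot rotation_block_cong[of 2 r e' e b] e'(4) by (simp add: N_def)
      \<comment> \<open>The images of the old block are spanned by \<open>e 1\<close> and
        \<open>v\<close>, which lie in the span of the new block as well.\<close>
      show "K z = 0" if z: "z \<in> perp {0..2 + 2 * r} e'" for z
      proof (rule in_kernel_if_perp_range[OF fr rot ker])
        have z': "g (e' j) z = 0" if "j \<in> {0..N}" for j using z that by (simp add: perp_def N_def)
        have \<sigma>0: "\<sigma> \<noteq> 0" using \<sigma>(1) by auto
        have "g x z = 0" "g (e 1) z = 0" "g (v - x) z = 0"
          using z'[of 0] z'[of 1] z'[of 2] \<sigma>0 by (simp_all add: e' N_def g_scale del: One_nat_def)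
        then have 1: "g (e 1) z = 0" "g (e 0 + e 2) z = 0" by (simp_all add: g_simps v_def)
        show "g (K (e j)) z = 0" if "j \<le> 2" for j
        proof -
          have "j = 0 \<or> j = 1 \<or> j = 2" using that by auto
          then show ?thesis using 1 K by (auto simp: g_minus)
        qed
        show "g (e j) z = 0" if "2 < j" "j \<le> 2 + 2 * r" for j
          using z'[of j] e'(4)[of j] that by (simp add: N_def)
      qed
      have "K (d - \<gamma> *\<^sub>R e 1 + (c * k) *\<^sub>R e 1) + \<phi> = (c *\<^sub>R e 0 + s) + (c * k) *\<^sub>R v"
        unfolding linear_add[OF linear_K, of "d - \<gamma> *\<^sub>R e 1"] linear_scale[OF linear_K] K(2)
          v_def[symmetric] \<psi>[symmetric] by (simp only: add_ac)
      also have "\<dots> = c *\<^sub>R x" using 3 by (simp add: x_def y_def scaleR_add_right)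
      also have "\<dots> = \<bar>c\<bar> *\<^sub>R e' 0 + 0 *\<^sub>R e' n" using \<sigma> by (simp add: e')
      finally show "K (d - \<gamma> *\<^sub>R e 1 + (c * k) *\<^sub>R e 1) + \<phi> = \<bar>c\<bar> *\<^sub>R e' 0 + 0 *\<^sub>R e' n" .
      show "killing_normal_form n \<iota> (\<lambda>x. lorentz_form 2 a x
        + (\<Sum>i=1..r. b i *\<^sub>R rot \<iota> (2 + 2 * i - 1) (2 + 2 * i) x)
        + (- \<bar>c\<bar>) *\<^sub>R dx \<iota> 0 + 0 *\<^sub>R dx \<iota> n)"
        using frame_le[OF fr] by (intro nf) auto
    qed (use frame_le[OF fr] in auto)
  qed
qed

lemma brought_into_normal_form: brought_into_normal_form
proof -
  obtain m a e0 where e0: "frame {0..m} e0" "lorentz_block m a e0" by (rule exists_lorentz_block)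
  have lor0: "K (e0 j) \<in> span (e0 ` {0..m})" if "j \<le> m" for j
  proof -
    have mem: "e0 k \<in> span (e0 ` {0..m})" if "k \<le> m" for k using that by (intro span_base) auto
    have "j \<in> {0, 1, 2}" using that e0(2) by (auto simp: lorentz_block_def)
    then show ?thesis using e0(2) that mem[of 0] mem[of 1] mem[of 2]
      by (auto simp: lorentz_block_def intro!: span_scale span_add span_neg span_0)
  qed
  obtain r b e where
    e: "\<And>j. j \<le> m \<Longrightarrow> e j = e0 j" "frame {0..m + 2 * r} e" "rotation_block m r b e"
      "antimono_on {1..r} b" "\<And>z. z \<in> perp {0..m + 2 * r} e \<Longrightarrow> K z = 0"
    by (rule exists_rotation_block[OF _ e0(1)], erule lor0, rule that)
  have lor: "lorentz_block m a e" using e0(2) lorentz_block_cong[of m e e0] e(1) by simp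
  then consider "m = 0" | "m = 1" | "m = 2" by (auto simp: lorentz_block_def)
  then show ?thesis
  proof cases
    case 1
    show ?thesis
      by (rule stationary_case[OF e(2)[unfolded 1] lor[unfolded 1] e(3)[unfolded 1] e(4) e(5)[unfolded 1]])
  next
    case 2
    show ?thesis
      by (rule boost_case[OF e(2)[unfolded 2] lor[unfolded 2] e(3)[unfolded 2] e(4) e(5)[unfolded 2]])
  next
    case 3
    show ?thesis
      by (rule null_case[OF e(2)[unfolded 3] lor[unfolded 3] e(3)[unfolded 3] e(4) e(5)[unfolded 3]])
  qed
qed

end

subsection \<open>Killing fields are affine\<close>

text \<open>
  Along a line with direction \<open>v\<close> the derivative of \<open>\<xi> \<bullet> v\<close> is the symmetrised gradient of \<open>\<xi>\<close> at
  \<open>(v, v)\<close>, which vanishes by the Killing equation. This makes \<open>\<xi>\<close> affine without any recourse to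
  second derivatives.
\<close>

lemma killing_increment_perp:
  fixes \<xi> :: "real ^ 'd::finite \<Rightarrow> real ^ 'd"
  assumes "killing_field_dual \<xi>"
  shows "(\<xi> x - \<xi> y) \<bullet> (x - y) = 0"
proof -
  define v where "v = x - y"
  define P where "P \<mu> \<nu> z = partial \<mu> (\<lambda>y. \<xi> y $ \<nu>) z" for \<mu> \<nu> z
  define F where "F \<nu> z = frechet_derivative (\<lambda>y. \<xi> y $ \<nu>) (at z)" for \<nu> z
  have anti: "P \<mu> \<nu> z = - P \<nu> \<mu> z" for \<mu> \<nu> z
    using assms unfolding killing_field_dual_def P_def by (simp add: eq_neg_iff_add_eq_0)
  have "cont_diff (Suc 0) (\<lambda>y. \<xi> y $ \<nu>)" for \<nu>
    using assms unfolding killing_field_dual_def smooth_def by blast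
  then have F: "((\<lambda>y. \<xi> y $ \<nu>) has_derivative F \<nu> z) (at z)" for \<nu> z
    unfolding F_def by (simp add: frechet_derivative_works)
  have F_v: "F \<nu> z v = (\<Sum>\<mu>\<in>UNIV. v $ \<mu> * P \<mu> \<nu> z)" for \<nu> z
  proof -
    have lin: "linear (F \<nu> z)" using F by (rule has_derivative_linear)
    have "v = (\<Sum>\<mu>\<in>UNIV. v $ \<mu> *\<^sub>R axis \<mu> 1)"
      by (simp add: vec_eq_iff axis_def if_distrib[of "\<lambda>x. _ * x"] cong: if_cong)
    then have "F \<nu> z v = (\<Sum>\<mu>\<in>UNIV. F \<nu> z (v $ \<mu> *\<^sub>R axis \<mu> 1))"
      by (metis linear_sum[OF lin])
    then show ?thesis
      by (simp add: linear_scale[OF lin[unfolded F_def]] P_def partial_def F_def)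
  qed
  have F0: "(\<Sum>\<nu>\<in>UNIV. F \<nu> z v * v $ \<nu>) = 0" for z
  proof -
    have "(\<Sum>\<nu>\<in>UNIV. F \<nu> z v * v $ \<nu>) = (\<Sum>\<nu>\<in>UNIV. \<Sum>\<mu>\<in>UNIV. v $ \<mu> * P \<mu> \<nu> z * v $ \<nu>)"
      by (simp add: F_v sum_distrib_right)
    also have "\<dots> = (\<Sum>\<mu>\<in>UNIV. \<Sum>\<nu>\<in>UNIV. v $ \<mu> * P \<mu> \<nu> z * v $ \<nu>)" by (rule sum.swap)
    also have "\<dots> = - (\<Sum>\<mu>\<in>UNIV. \<Sum>\<nu>\<in>UNIV. v $ \<nu> * P \<nu> \<mu> z * v $ \<mu>)"
      unfolding sum_negf[symmetric] by (intro sum.cong refl) (subst anti, simp)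
    also have "\<dots> = - (\<Sum>\<nu>\<in>UNIV. F \<nu> z v * v $ \<nu>)"
      by (simp add: F_v sum_distrib_right)
    finally show ?thesis by simp
  qed
  define h where "h t = (\<Sum>\<nu>\<in>UNIV. \<xi> (y + t *\<^sub>R v) $ \<nu> * v $ \<nu>)" for t :: real
  have "DERIV h t :> 0" for t
  proof -
    have "((\<lambda>t. \<xi> (y + t *\<^sub>R v) $ \<nu>) has_derivative (\<lambda>s. F \<nu> (y + t *\<^sub>R v) (s *\<^sub>R v))) (at t)" for \<nu>
      by (rule has_derivative_compose[where g = "\<lambda>y. \<xi> y $ \<nu>", OF _ F])
        (auto intro!: derivative_eq_intros)
    then have "((\<lambda>t. \<xi> (y + t *\<^sub>R v) $ \<nu>) has_field_derivative F \<nu> (y + t *\<^sub>R v) v) (at t)" for \<nu>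
      unfolding has_field_derivative_def
      by (rule has_derivative_eq_rhs)
        (simp add: fun_eq_iff linear_scale[OF has_derivative_linear[OF F]] mult.commute)
    then have "DERIV h t :> (\<Sum>\<nu>\<in>UNIV. F \<nu> (y + t *\<^sub>R v) v * v $ \<nu>)"
      unfolding h_def by (intro DERIV_sum DERIV_cmult_right)
    then show ?thesis by (simp add: F0)
  qed
  then have "h 1 = h 0" using DERIV_isconst_all by blast
  then show ?thesis
    by (simp add: h_def v_def inner_vec_def sum_subtractf left_diff_distrib)
qed

text \<open>Polarising \<open>killing_increment_perp\<close> makes the increment skew for the
  Euclidean product. A skew map is automatically linear, because its argument can be moved to the
  other factor.\<close>

lemma killing_linear_part:
  fixes \<xi> :: "real ^ 'd::finite \<Rightarrow> real ^ 'd"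
  assumes "killing_field_dual \<xi>"
  shows "linear (\<lambda>x. \<xi> x - \<xi> 0)" and "(\<xi> x - \<xi> 0) \<bullet> y = - ((\<xi> y - \<xi> 0) \<bullet> x)"
proof -
  define L where "L x = \<xi> x - \<xi> 0" for x
  have self: "L x \<bullet> x = 0" for x using killing_increment_perp[OF assms, of x 0] by (simp add: L_def)
  have skew: "L x \<bullet> y = - (L y \<bullet> x)" for x y
    using killing_increment_perp[OF assms, of x y] self[of x] self[of y]
    by (simp add: L_def inner_diff_left inner_diff_right)
  have "L (x + y) \<bullet> z = (L x + L y) \<bullet> z" for x y z
    using skew[of "x + y" z] skew[of x z] skew[of y z] by (simp add: inner_add_left inner_add_right)
  then have "L (x + y) = L x + L y" for x y
    using vector_eq_rdot[of "L (x + y)" "L x + L y"] by blast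
  moreover have "L (c *\<^sub>R x) \<bullet> z = (c *\<^sub>R L x) \<bullet> z" for c x z
    using skew[of "c *\<^sub>R x" z] skew[of x z] by simp
  then have "L (c *\<^sub>R x) = c *\<^sub>R L x" for c x
    using vector_eq_rdot[of "L (c *\<^sub>R x)" "c *\<^sub>R L x"] by blast
  ultimately have "linear L" by (rule linearI)
  then show "linear (\<lambda>x. \<xi> x - \<xi> 0)" unfolding L_def .
  show "(\<xi> x - \<xi> 0) \<bullet> y = - ((\<xi> y - \<xi> 0) \<bullet> x)" using skew[of x y] unfolding L_def .
qed

theorem theorem2:
  fixes n :: nat and \<iota> :: "nat \<Rightarrow> 'd::finite" and \<xi> :: "real ^ 'd \<Rightarrow> real ^ 'd"
  assumes "n \<ge> 1"
    and "bij_betw \<iota> {0..n} UNIV"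
    and "killing_field_dual \<xi>"
    and "\<xi> \<noteq> (\<lambda>x. 0)"
  shows "\<exists>\<Lambda> \<in> lorentz_group (\<iota> 0). \<exists>c \<omega>.
    killing_normal_form n \<iota> \<omega> \<and> \<xi> = from_new_coords \<Lambda> c \<omega>"
proof -
  interpret minkowski "\<iota> 0" .
  \<comment> \<open>Raising the index turns Euclidean skewness of the linear part into skewness for
    \<open>g\<close>.\<close>
  define K where "K x = time_flip (\<xi> x - \<xi> 0)" for x
  have linear_K: "linear K"
    unfolding K_def using linear_compose[OF killing_linear_part(1)[OF assms(3)] linear_time_flip]
    by (simp add: o_def)
  interpret killing_field \<iota> K n "time_flip (\<xi> 0)" \<xi>
  proof unfold_locales
    show "K (u + v) = K u + K v" "K (c *\<^sub>R u) = c *\<^sub>R K u" for u v c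
      by (fact linear_add[OF linear_K] linear_scale[OF linear_K])+
    show "g (K u) v = - g u (K v)" for u v
      using killing_linear_part(2)[OF assms(3), of u v]
      by (simp add: K_def g_time_flip inner_commute)
    show "\<xi> y = time_flip (K y + time_flip (\<xi> 0))" for y
      by (simp add: K_def linear_add[OF linear_time_flip])
  qed (use assms in auto)
  show ?thesis using brought_into_normal_form unfolding brought_into_normal_form_def .
qed

end
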